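(* Let $k$ be a field of characteristic zero. For every $n\geq 4$ there exists a central hyperplane arrangement of rank $n$ in the affine space $\mathbb A_k^n$ whose gradient ideal is not of linear type.
   Context: A central hyperplane arrangement in $\mathbb A^n_k$ is a finite collection of distinct hyperplanes $V(\ell_i)$ through the origin, with $\ell_1,\ldots,\ell_m\in R=k[x_1,\ldots,x_n]$ nonzero, pairwise non-proportional linear forms; its rank is $\dim_k\langle\ell_1,\ldots,\ell_m\rangle$. Its gradient (Jacobian) ideal is $J_f=(\partial f/\partial x_1,\ldots,\partial f/\partial x_n)\subseteq R$, where $f=\ell_1\cdots\ell_m$. An ideal $J$ of a Noetherian ring $A$ is of linear type if the canonical surjection $\operatorname{Sym}_A(J)\to\mathcal R_A(J)=A[Jt]\subseteq A[t]$ from its symmetric algebra onto its Rees algebra is injective. *)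

theory Defs
  imports
    "HOL-Library.Poly_Mapping"
    "HOL-Library.Cardinality"
    "HOL-Computational_Algebra.Polynomial"
    "HOL-Algebra.Generated_Rings"
begin

section \<open>Multivariate polynomials\<close>

text \<open>
  Polynomials with coefficients in \<open>'a\<close> and variables indexed by \<open>'v\<close>: finitely supported
  coefficient functions on exponent vectors. For a finite index type \<open>'n\<close> and a field \<open>'k\<close>,
  the type \<open>('n, 'k) mpoly\<close> is the ring \<open>k[x_1, ..., x_n]\<close> with \<open>n = CARD('n)\<close>.
\<close>

type_synonym ('v, 'a) mpoly = "('v \<Rightarrow>\<^sub>0 nat) \<Rightarrow>\<^sub>0 'a"

definition Const :: "'a::comm_ring_1 \<Rightarrow> ('v, 'a) mpoly"
  where "Const a = Poly_Mapping.single 0 a"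

definition Var :: "'v \<Rightarrow> ('v, 'a::comm_ring_1) mpoly"
  where "Var i = Poly_Mapping.single (Poly_Mapping.single i 1) 1"

definition mscale :: "'a::comm_ring_1 \<Rightarrow> ('v, 'a) mpoly \<Rightarrow> ('v, 'a) mpoly"
  where "mscale c p = Const c * p"

definition pdiff :: "'v \<Rightarrow> ('v, 'a::comm_ring_1) mpoly \<Rightarrow> ('v, 'a) mpoly"
  where "pdiff i p =
    (\<Sum>m\<in>Poly_Mapping.keys p. Poly_Mapping.single (m - Poly_Mapping.single i 1)
        (of_nat (Poly_Mapping.lookup m i) * Poly_Mapping.lookup p m))"

text \<open>
  Evaluation along a ring homomorphism \<open>\<phi>\<close> on the coefficients, with \<open>\<xi> i\<close> substituted for the
  \<open>i\<close>-th variable.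
\<close>

definition meval :: "('a::comm_ring_1 \<Rightarrow> 'b::comm_ring_1) \<Rightarrow> ('v \<Rightarrow> 'b) \<Rightarrow> ('v, 'a) mpoly \<Rightarrow> 'b"
  where "meval \<phi> \<xi> p =
    (\<Sum>m\<in>Poly_Mapping.keys p. \<phi> (Poly_Mapping.lookup p m) *
        (\<Prod>i\<in>Poly_Mapping.keys m. \<xi> i ^ Poly_Mapping.lookup m i))"

definition mpolys_in :: "'v set \<Rightarrow> ('v, 'a::comm_ring_1) mpoly set"
  where "mpolys_in V = {p. \<forall>m\<in>Poly_Mapping.keys p. Poly_Mapping.keys m \<subseteq> V}"


section \<open>Symmetric algebras, Rees algebras, ideals of linear type\<close>

definition ring_on :: "'a::comm_ring_1 set \<Rightarrow> 'a ring"
  where "ring_on S = \<lparr>carrier = S, mult = (*), one = 1, zero = 0, add = (+)\<rparr>"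

text \<open>
  The symmetric algebra of an ideal \<open>J\<close> of \<open>A\<close> (the type \<open>'a\<close>), considered as an \<open>A\<close>-module:
  the polynomial ring over \<open>A\<close> in one variable for each element of \<open>J\<close>, modulo the
  ideal generated by the relations expressing that \<open>g \<mapsto> Var g\<close> is \<open>A\<close>-linear on \<open>J\<close>.
\<close>

definition sym_relations :: "'a::comm_ring_1 set \<Rightarrow> ('a, 'a) mpoly set"
  where "sym_relations J =
    {Var (g + h) - Var g - Var h | g h. g \<in> J \<and> h \<in> J} \<union>
    {Var (a * g) - Const a * Var g | a g. g \<in> J}"

definition sym_ideal :: "'a::comm_ring_1 set \<Rightarrow> ('a, 'a) mpoly set"
  where "sym_ideal J = genideal (ring_on (mpolys_in J)) (sym_relations J)"

definition sym_algebra :: "'a::comm_ring_1 set \<Rightarrow> ('a, 'a) mpoly set ring"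
  where "sym_algebra J = ring_on (mpolys_in J) Quot sym_ideal J"

text \<open>The subring \<open>A[Jt]\<close> of \<open>A[t]\<close>; here \<open>Polynomial.monom g 1\<close> is \<open>g t\<close>.\<close>

definition rees_algebra :: "'a::comm_ring_1 set \<Rightarrow> 'a poly ring"
  where "rees_algebra J = ring_on
    (generate_ring (ring_on UNIV) (range (\<lambda>a. [:a:]) \<union> (\<lambda>g. Polynomial.monom g 1) ` J))"

text \<open>
  The canonical surjection is induced on cosets by \<open>Var g \<mapsto> g t\<close>; see
  \<open>sym_to_rees_coset\<close>, \<open>sym_to_rees_hom\<close> and \<open>sym_to_rees_surj\<close> below.
\<close>

definition rees_eval :: "('a::comm_ring_1, 'a) mpoly \<Rightarrow> 'a poly"
  where "rees_eval = meval (\<lambda>a. [:a:]) (\<lambda>g. Polynomial.monom g 1)"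

definition sym_to_rees :: "('a::comm_ring_1, 'a) mpoly set \<Rightarrow> 'a poly"
  where "sym_to_rees C = the_elem (rees_eval ` C)"

definition linear_type :: "'a::comm_ring_1 set \<Rightarrow> bool"
  where "linear_type J \<longleftrightarrow> inj_on sym_to_rees (carrier (sym_algebra J))"


section \<open>Central hyperplane arrangements\<close>

definition linear_form :: "('n::finite, 'k::field) mpoly \<Rightarrow> bool"
  where "linear_form l \<longleftrightarrow> (\<exists>a. l = (\<Sum>i\<in>UNIV. mscale (a i) (Var i)))"

definition vanishing_locus :: "('n::finite, 'k::field) mpoly \<Rightarrow> ('n \<Rightarrow> 'k) set"
  where "vanishing_locus p = {x. meval id x p = 0}"

text \<open>
  \<open>central_arrangement \<A> ls\<close>: \<open>\<A>\<close> is the central arrangement in affine \<open>n\<close>-space whose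
  hyperplanes are cut out by the forms in the list \<open>ls\<close>, one form for each hyperplane.
\<close>

definition central_arrangement :: "('n::finite \<Rightarrow> 'k::field) set set \<Rightarrow> ('n, 'k) mpoly list \<Rightarrow> bool"
  where "central_arrangement \<A> ls \<longleftrightarrow>
    (\<forall>l\<in>set ls. linear_form l \<and> l \<noteq> 0) \<and>
    (\<forall>i<length ls. \<forall>j<length ls. i \<noteq> j \<longrightarrow> (\<forall>c. ls ! i \<noteq> mscale c (ls ! j))) \<and>
    \<A> = vanishing_locus ` set ls"

lemma vector_space_mscale: "vector_space (mscale :: 'k::field \<Rightarrow> ('v, 'k) mpoly \<Rightarrow> _)"
  by unfold_locales
    (simp_all add: mscale_def Const_def algebra_simps single_add mult_single flip: mult.assoc)

definition arrangement_rank :: "('n::finite, 'k::field) mpoly list \<Rightarrow> nat"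
  where "arrangement_rank ls = vector_space.dim mscale (module.span mscale (set ls))"

definition gradient_ideal :: "('n::finite, 'k::field) mpoly \<Rightarrow> ('n, 'k) mpoly set"
  where "gradient_ideal f = genideal (ring_on UNIV) (range (\<lambda>i. pdiff i f))"


section \<open>The canonical surjection from the symmetric algebra onto the Rees algebra\<close>

lemma cring_ring_on:
  assumes "1 \<in> S" "\<And>x y. x \<in> S \<Longrightarrow> y \<in> S \<Longrightarrow> x + y \<in> S"
    "\<And>x y. x \<in> S \<Longrightarrow> y \<in> S \<Longrightarrow> x * y \<in> S" "\<And>x. x \<in> S \<Longrightarrow> - x \<in> S"
  shows "cring (ring_on S)"
proof -
  have 0: "0 \<in> S" using assms(1) assms(2)[OF assms(1) assms(4)[OF assms(1)]] by simp
  show ?thesis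
    by (intro cringI abelian_groupI comm_monoidI)
      (auto simp: ring_on_def assms 0 algebra_simps intro: bexI[where x = "- _"])
qed

lemma meval_superset:
  assumes "finite T" "Poly_Mapping.keys p \<subseteq> T" "\<phi> 0 = 0"
  shows "meval \<phi> \<xi> p = (\<Sum>m\<in>T. \<phi> (Poly_Mapping.lookup p m) *
        (\<Prod>i\<in>Poly_Mapping.keys m. \<xi> i ^ Poly_Mapping.lookup m i))"
  unfolding meval_def
  by (rule sum.mono_neutral_left) (use assms in \<open>auto simp: in_keys_iff\<close>)

lemma mono_prod_superset:
  fixes \<xi> :: "'v \<Rightarrow> 'b::comm_ring_1"
  assumes "finite T" "Poly_Mapping.keys m \<subseteq> T"
  shows "(\<Prod>i\<in>Poly_Mapping.keys m. \<xi> i ^ Poly_Mapping.lookup m i) =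
    (\<Prod>i\<in>T. \<xi> i ^ Poly_Mapping.lookup m i)"
  by (rule prod.mono_neutral_left) (use assms in \<open>auto simp: in_keys_iff\<close>)

lemma mono_prod_add:
  fixes \<xi> :: "'v \<Rightarrow> 'b::comm_ring_1"
  shows "(\<Prod>i\<in>Poly_Mapping.keys (m + n). \<xi> i ^ Poly_Mapping.lookup (m + n) i) =
    (\<Prod>i\<in>Poly_Mapping.keys m. \<xi> i ^ Poly_Mapping.lookup m i) *
    (\<Prod>i\<in>Poly_Mapping.keys n. \<xi> i ^ Poly_Mapping.lookup n i)"
proof -
  let ?T = "Poly_Mapping.keys m \<union> Poly_Mapping.keys n"
  have "Poly_Mapping.keys (m + n) \<subseteq> ?T" by (rule keys_add)
  then show ?thesis
    by (subst (1 2 3) mono_prod_superset[of ?T]) (auto simp: lookup_add power_add prod.distrib)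
qed

lemma mpoly_induct [case_names single add]:
  fixes p :: "('v, 'a::comm_ring_1) mpoly"
  assumes s: "\<And>m a. P (Poly_Mapping.single m a)" and a: "\<And>p q. P p \<Longrightarrow> P q \<Longrightarrow> P (p + q)"
  shows "P p"
proof -
  have eq: "p = (\<Sum>m\<in>Poly_Mapping.keys p. Poly_Mapping.single m (Poly_Mapping.lookup p m))"
  proof (rule poly_mapping_eqI)
    fix k
    have "(\<Sum>m\<in>Poly_Mapping.keys p.
          Poly_Mapping.lookup (Poly_Mapping.single m (Poly_Mapping.lookup p m)) k) =
        (\<Sum>m\<in>Poly_Mapping.keys p. if m = k then Poly_Mapping.lookup p k else 0)"
      by (rule sum.cong) (auto simp: lookup_single)
    then show "Poly_Mapping.lookup p k = Poly_Mapping.lookup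
        (\<Sum>m\<in>Poly_Mapping.keys p. Poly_Mapping.single m (Poly_Mapping.lookup p m)) k"
      by (simp add: lookup_sum in_keys_iff)
  qed
  have "P (\<Sum>m\<in>S. Poly_Mapping.single m (Poly_Mapping.lookup p m))" if "finite S" for S
    using that
  proof (induction S)
    case empty
    show ?case using s[of 0 0] by simp
  qed (auto intro: s a)
  then show ?thesis by (subst eq) simp
qed

locale coeff_hom =
  fixes \<phi> :: "'a::comm_ring_1 \<Rightarrow> 'b::comm_ring_1"
  assumes one: "\<phi> 1 = 1" and add: "\<phi> (a + b) = \<phi> a + \<phi> b" and mult: "\<phi> (a * b) = \<phi> a * \<phi> b"
begin

lemma zero: "\<phi> 0 = 0"
  using add[of 0 0] by simp

lemma meval_add: "meval \<phi> \<xi> (p + q) = meval \<phi> \<xi> p + meval \<phi> \<xi> q"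
proof -
  let ?T = "Poly_Mapping.keys p \<union> Poly_Mapping.keys q"
  have "Poly_Mapping.keys (p + q) \<subseteq> ?T" by (rule keys_add)
  then show ?thesis
    by (subst (1 2 3) meval_superset[of ?T])
      (auto simp: zero lookup_add add distrib_right sum.distrib)
qed

lemma meval_single: "meval \<phi> \<xi> (Poly_Mapping.single m a) =
    \<phi> a * (\<Prod>i\<in>Poly_Mapping.keys m. \<xi> i ^ Poly_Mapping.lookup m i)"
  by (subst meval_superset[of "{m}"]) (auto simp: zero)

lemma meval_mult: "meval \<phi> \<xi> (p * q) = meval \<phi> \<xi> p * meval \<phi> \<xi> q"
proof (induction p rule: mpoly_induct)
  case (single m a)
  show ?case
  proof (induction q rule: mpoly_induct)
    case (single n b)
    show ?case by (simp add: mult_single meval_single mono_prod_add mult ac_simps)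
  qed (simp add: distrib_left meval_add)
qed (simp add: distrib_right meval_add)

lemma meval_Const: "meval \<phi> \<xi> (Const a) = \<phi> a"
  by (simp add: Const_def meval_single)

lemma meval_Var: "meval \<phi> \<xi> (Var i) = \<xi> i"
  by (simp add: Var_def meval_single one)

lemma meval_one: "meval \<phi> \<xi> 1 = 1"
  using meval_Const[of _ 1] by (simp add: Const_def one)

lemma meval_diff: "meval \<phi> \<xi> (p - q) = meval \<phi> \<xi> p - meval \<phi> \<xi> q"
  using meval_add[of \<xi> "p - q" q] by simp

lemma meval_uminus: "meval \<phi> \<xi> (- p) = - meval \<phi> \<xi> p"
  using meval_diff[of \<xi> 0 p] meval_diff[of \<xi> 0 0] by simp

end

lemma Const_in: "Const a \<in> mpolys_in V"
  by (auto simp: mpolys_in_def Const_def)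

lemma Var_in: "i \<in> V \<Longrightarrow> Var i \<in> mpolys_in V"
  by (auto simp: mpolys_in_def Var_def)

lemma mpolys_in_add: "p \<in> mpolys_in V \<Longrightarrow> q \<in> mpolys_in V \<Longrightarrow> p + q \<in> mpolys_in V"
  using keys_add[of p q] unfolding mpolys_in_def by blast

lemma mpolys_in_uminus: "p \<in> mpolys_in V \<Longrightarrow> - p \<in> mpolys_in V"
  by (simp add: mpolys_in_def)

lemma mpolys_in_diff: "p \<in> mpolys_in V \<Longrightarrow> q \<in> mpolys_in V \<Longrightarrow> p - q \<in> mpolys_in V"
  using mpolys_in_add[of p V "- q"] by (simp add: mpolys_in_uminus)

lemma mpolys_in_mult: "p \<in> mpolys_in V \<Longrightarrow> q \<in> mpolys_in V \<Longrightarrow> p * q \<in> mpolys_in V"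
  unfolding mpolys_in_def
  by (clarify dest!: subsetD[OF keys_mult]) (metis UnE keys_add subsetD)

lemma mpolys_in_one: "1 \<in> mpolys_in V"
  using Const_in[of 1] by (simp add: Const_def)

lemma cring_mpolys_in: "cring (ring_on (mpolys_in V))"
  by (rule cring_ring_on)
    (auto intro: mpolys_in_one mpolys_in_add mpolys_in_mult mpolys_in_uminus)

lemma cring_ring_on_UNIV: "cring (ring_on UNIV)"
  by (rule cring_ring_on) auto

lemma ring_on_a_inv:
  assumes "cring (ring_on S)" "x \<in> S" "- x \<in> S"
  shows "\<ominus>\<^bsub>ring_on S\<^esub> x = - x"
proof -
  interpret cring "ring_on S" by fact
  show ?thesis by (rule minus_equality) (use assms in \<open>auto simp: ring_on_def\<close>)
qed

lemma sym_relations_in: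
  assumes "ideal J (ring_on UNIV)"
  shows "sym_relations J \<subseteq> mpolys_in J"
proof -
  interpret ideal J "ring_on UNIV" by fact
  have "g + h \<in> J" if "g \<in> J" "h \<in> J" for g h
    using additive_subgroup.a_closed[OF additive_subgroup_axioms that] by (simp add: ring_on_def)
  moreover have "a * g \<in> J" if "g \<in> J" for a g
    using I_l_closed[OF that, of a] by (simp add: ring_on_def)
  ultimately show ?thesis
    by (auto simp: sym_relations_def intro!: mpolys_in_diff mpolys_in_mult Var_in Const_in)
qed

interpretation pCons0: coeff_hom "\<lambda>a::'a::comm_ring_1. [:a:]"
  by unfold_locales (simp_all add: one_pCons)

lemmas rees_eval_simps =
  pCons0.meval_add[of "\<lambda>g. Polynomial.monom g 1", folded rees_eval_def]
  pCons0.meval_diff[of "\<lambda>g. Polynomial.monom g 1", folded rees_eval_def]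
  pCons0.meval_uminus[of "\<lambda>g. Polynomial.monom g 1", folded rees_eval_def]
  pCons0.meval_mult[of "\<lambda>g. Polynomial.monom g 1", folded rees_eval_def]
  pCons0.meval_one[of "\<lambda>g. Polynomial.monom g 1", folded rees_eval_def]
  pCons0.meval_Const[of "\<lambda>g. Polynomial.monom g 1", folded rees_eval_def]
  pCons0.meval_Var[of "\<lambda>g. Polynomial.monom g 1", folded rees_eval_def]

lemma rees_eval_hom: "ring_hom_ring (ring_on (mpolys_in J)) (ring_on UNIV) rees_eval"
  by (rule ring_hom_ringI2[OF cring.axioms(1)[OF cring_mpolys_in] cring.axioms(1)[OF cring_ring_on_UNIV]])
    (rule ring_hom_memI;
      simp add: ring_on_def rees_eval_simps)

lemma
  assumes J: "ideal J (ring_on UNIV)"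
  shows ideal_sym_ideal: "ideal (sym_ideal J) (ring_on (mpolys_in J))"
    and rees_eval_sym_ideal: "p \<in> sym_ideal J \<Longrightarrow> rees_eval p = 0"
proof -
  interpret P: cring "ring_on (mpolys_in J)" by (rule cring_mpolys_in)
  interpret H: ring_hom_ring "ring_on (mpolys_in J)" "ring_on UNIV" rees_eval
    by (rule rees_eval_hom)
  have sub: "sym_relations J \<subseteq> carrier (ring_on (mpolys_in J))"
    using sym_relations_in[OF J] by (simp add: ring_on_def)
  show "ideal (sym_ideal J) (ring_on (mpolys_in J))"
    unfolding sym_ideal_def by (rule P.genideal_ideal[OF sub])
  have "rees_eval p = 0" if "p \<in> sym_relations J" for p
    using that unfolding sym_relations_def
    by (elim UnE CollectE exE conjE)
      (simp_all only: rees_eval_simps,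
        simp_all add: add_monom[symmetric] smult_monom)
  then have "sym_relations J \<subseteq> a_kernel (ring_on (mpolys_in J)) (ring_on UNIV) rees_eval"
    using sub unfolding a_kernel_def kernel_def by (simp add: ring_on_def subset_iff)
  then have "sym_ideal J \<subseteq> a_kernel (ring_on (mpolys_in J)) (ring_on UNIV) rees_eval"
    unfolding sym_ideal_def by (rule P.genideal_minimal[OF H.kernel_is_ideal])
  then show "p \<in> sym_ideal J \<Longrightarrow> rees_eval p = 0"
    unfolding a_kernel_def kernel_def by (simp add: ring_on_def subset_iff)
qed

lemma sym_to_rees_coset:
  assumes J: "ideal J (ring_on UNIV)"
  shows "sym_to_rees (sym_ideal J +>\<^bsub>ring_on (mpolys_in J)\<^esub> p) = rees_eval p"
proof -
  interpret I: ideal "sym_ideal J" "ring_on (mpolys_in J)" by (rule ideal_sym_ideal[OF J])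
  have "0 \<in> sym_ideal J"
    using additive_subgroup.zero_closed[OF I.additive_subgroup_axioms] by (simp add: ring_on_def)
  moreover have "sym_ideal J +>\<^bsub>ring_on (mpolys_in J)\<^esub> p = (\<lambda>h. h + p) ` sym_ideal J"
    by (auto simp: a_r_coset_def r_coset_def ring_on_def)
  moreover have "(\<lambda>h. rees_eval (h + p)) ` sym_ideal J = (\<lambda>h. rees_eval p) ` sym_ideal J"
    by (intro image_cong) (simp_all add: rees_eval_simps rees_eval_sym_ideal[OF J])
  ultimately have "rees_eval ` (sym_ideal J +>\<^bsub>ring_on (mpolys_in J)\<^esub> p) = {rees_eval p}"
    by (auto simp: image_image)
  then show ?thesis by (simp add: sym_to_rees_def)
qed

lemma rees_eval_image:
  "rees_eval ` mpolys_in J = carrier (rees_algebra J)"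
proof -
  let ?H = "range (\<lambda>a. [:a:]) \<union> (\<lambda>g. Polynomial.monom g 1) ` J"
  let ?G = "generate_ring (ring_on UNIV) ?H"
  have "q \<in> rees_eval ` mpolys_in J" if "q \<in> ?G" for q
    using that
  proof induction
    case one
    show ?case
      by (rule image_eqI[of _ _ 1]) (simp_all add: ring_on_def rees_eval_simps mpolys_in_one)
  next
    case (incl h)
    then consider a where "h = [:a:]" | g where "g \<in> J" "h = Polynomial.monom g 1" by blast
    then show ?case
    proof cases
      case 1
      then show ?thesis
        by (intro image_eqI[of _ _ "Const _"]) (simp_all only: rees_eval_simps Const_in)
    next
      case 2
      then show ?thesis
        by (intro image_eqI[of _ _ "Var g"]) (auto intro: Var_in simp only: rees_eval_simps)
    qed
  next
    case (a_inv h)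
    then obtain p where "p \<in> mpolys_in J" "h = rees_eval p" by auto
    then have "\<ominus>\<^bsub>ring_on UNIV\<^esub> h = rees_eval (- p)" "- p \<in> mpolys_in J"
      by (simp_all only: rees_eval_simps ring_on_a_inv[OF cring_ring_on_UNIV] UNIV_I
          mpolys_in_uminus)
    then show ?case by (rule image_eqI)
  next
    case (eng_add h1 h2)
    then obtain p q where "p \<in> mpolys_in J" "h1 = rees_eval p" "q \<in> mpolys_in J" "h2 = rees_eval q"
      by auto
    then have "h1 \<oplus>\<^bsub>ring_on UNIV\<^esub> h2 = rees_eval (p + q)" "p + q \<in> mpolys_in J"
      by (simp_all add: ring_on_def rees_eval_simps mpolys_in_add)
    then show ?case by (rule image_eqI)
  next
    case (eng_mult h1 h2)
    then obtain p q where "p \<in> mpolys_in J" "h1 = rees_eval p" "q \<in> mpolys_in J" "h2 = rees_eval q"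
      by auto
    then have "h1 \<otimes>\<^bsub>ring_on UNIV\<^esub> h2 = rees_eval (p * q)" "p * q \<in> mpolys_in J"
      by (simp_all add: ring_on_def rees_eval_simps mpolys_in_mult)
    then show ?case by (rule image_eqI)
  qed
  moreover have "rees_eval p \<in> ?G" if "p \<in> mpolys_in J" for p
  proof -
    define G where "G = ?G"
    have ad: "x + y \<in> G" if "x \<in> G" "y \<in> G" for x y
      using generate_ring.eng_add[OF that[unfolded G_def]] by (simp add: ring_on_def G_def)
    have mu: "x * y \<in> G" if "x \<in> G" "y \<in> G" for x y
      using generate_ring.eng_mult[OF that[unfolded G_def]] by (simp add: ring_on_def G_def)
    have C: "[:a:] \<in> G" for a unfolding G_def by (rule generate_ring.incl) auto
    have V: "Polynomial.monom g 1 \<in> G" if "g \<in> J" for g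
      unfolding G_def using that by (intro generate_ring.incl) auto
    have pow: "Polynomial.monom g 1 ^ k \<in> G" if "g \<in> J" for g k
    proof (induction k)
      case 0
      show ?case using C[of 1] by (simp add: one_pCons)
    qed (use V[OF that] mu in simp)
    have pr: "(\<Prod>i\<in>T. Polynomial.monom i 1 ^ k i) \<in> G" if "finite T" "T \<subseteq> J" for T k
      using that
    proof (induction T)
      case empty
      show ?case using C[of 1] by (simp add: one_pCons)
    qed (use pow mu in auto)
    have "(\<Sum>m\<in>T. [:Poly_Mapping.lookup p m:] *
        (\<Prod>i\<in>Poly_Mapping.keys m. Polynomial.monom i 1 ^ Poly_Mapping.lookup m i)) \<in> G"
      if "finite T" "T \<subseteq> Poly_Mapping.keys p" for T
      using that
    proof (induction T)
      case empty
      show ?case using C[of 0] by simp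
    next
      case (insert m T)
      then have "Poly_Mapping.keys m \<subseteq> J"
        using \<open>p \<in> mpolys_in J\<close> by (auto simp: mpolys_in_def)
      then have "[:Poly_Mapping.lookup p m:] *
        (\<Prod>i\<in>Poly_Mapping.keys m. Polynomial.monom i 1 ^ Poly_Mapping.lookup m i) \<in> G"
        by (intro mu C pr finite_keys)
      with insert show ?case by (simp add: ad)
    qed
    from this[OF finite_keys order_refl] show ?thesis
      by (simp only: G_def rees_eval_def meval_def)
  qed
  ultimately have "rees_eval ` mpolys_in J = ?G" by blast
  then show ?thesis by (simp add: rees_algebra_def ring_on_def)
qed

lemma carrier_sym_algebra:
  "carrier (sym_algebra J) = (+>\<^bsub>ring_on (mpolys_in J)\<^esub>) (sym_ideal J) ` mpolys_in J"
proof -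
  have "carrier (ring_on (mpolys_in J)) = mpolys_in J" by (simp add: ring_on_def)
  then show ?thesis unfolding sym_algebra_def by (auto simp: FactRing_def A_RCOSETS_def' a_r_coset_def')
qed

theorem sym_to_rees_surj:
  assumes J: "ideal J (ring_on UNIV)"
  shows "sym_to_rees ` carrier (sym_algebra J) = carrier (rees_algebra J)"
  by (simp add: carrier_sym_algebra image_image sym_to_rees_coset[OF J] rees_eval_image)

theorem sym_to_rees_hom:
  assumes J: "ideal J (ring_on UNIV)"
  shows "sym_to_rees \<in> ring_hom (sym_algebra J) (rees_algebra J)"
proof (rule ring_hom_memI)
  interpret I: ideal "sym_ideal J" "ring_on (mpolys_in J)" by (rule ideal_sym_ideal[OF J])
  have cl: "p \<in> mpolys_in J \<Longrightarrow> p \<in> carrier (ring_on (mpolys_in J))" for p :: "('a, 'a) mpoly"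
    by (simp add: ring_on_def)
  have R: "mult (rees_algebra J) = (*)" "add (rees_algebra J) = (+)" "one (rees_algebra J) = 1"
    by (simp_all add: rees_algebra_def ring_on_def)
  have P: "mult (ring_on (mpolys_in J)) = (*)" "add (ring_on (mpolys_in J)) = (+)"
    "one (ring_on (mpolys_in J)) = 1"
    by (simp_all add: ring_on_def)
  fix C D
  assume C: "C \<in> carrier (sym_algebra J)"
  then show "sym_to_rees C \<in> carrier (rees_algebra J)"
    using sym_to_rees_surj[OF J] by blast
  assume D: "D \<in> carrier (sym_algebra J)"
  obtain p q where pq: "p \<in> mpolys_in J" "q \<in> mpolys_in J"
    "C = sym_ideal J +>\<^bsub>ring_on (mpolys_in J)\<^esub> p" "D = sym_ideal J +>\<^bsub>ring_on (mpolys_in J)\<^esub> q"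
    using C D by (auto simp: carrier_sym_algebra)
  show "sym_to_rees (C \<otimes>\<^bsub>sym_algebra J\<^esub> D) = sym_to_rees C \<otimes>\<^bsub>rees_algebra J\<^esub> sym_to_rees D"
    using I.rcoset_mult_add[OF cl[OF pq(1)] cl[OF pq(2)]]
    by (simp add: pq sym_algebra_def FactRing_def sym_to_rees_coset[OF J] R P rees_eval_simps)
  show "sym_to_rees (C \<oplus>\<^bsub>sym_algebra J\<^esub> D) = sym_to_rees C \<oplus>\<^bsub>rees_algebra J\<^esub> sym_to_rees D"
    using I.a_rcos_sum[OF cl[OF pq(1)] cl[OF pq(2)]]
    by (simp add: pq sym_algebra_def FactRing_def sym_to_rees_coset[OF J] R P rees_eval_simps)
next
  show "sym_to_rees \<one>\<^bsub>sym_algebra J\<^esub> = \<one>\<^bsub>rees_algebra J\<^esub>"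
    by (simp add: sym_algebra_def FactRing_def sym_to_rees_coset[OF J])
      (simp add: ring_on_def rees_algebra_def rees_eval_simps)
qed

theorem ideal_gradient_ideal: "ideal (gradient_ideal f) (ring_on UNIV)"
  unfolding gradient_ideal_def
  by (rule ring.genideal_ideal[OF cring.axioms(1)[OF cring_ring_on_UNIV]])
    (simp add: ring_on_def)

end

theory Submission
  imports Defs
begin

text \<open>
  Let \<open>p = (p\<^sub>0, p\<^sub>1, p\<^sub>2)\<close> and \<open>q = (q\<^sub>0, q\<^sub>1, q\<^sub>2)\<close> range over the triples with sum zero. In the
  resulting four-dimensional space the nine hyperplanes \<open>p\<^sub>i = q\<^sub>j\<close> form the arrangement that proves
  the theorem for \<open>n = 4\<close>; for larger \<open>n\<close> the coordinate hyperplanes of the remaining variables are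
  added. Write \<open>F\<close> for the product of all forms, \<open>J\<close> for its gradient ideal, \<open>g\<close> for the partial
  derivative of \<open>F\<close> by \<open>p\<^sub>0\<close> and \<open>I\<close> for the ideal generated by the other partial derivatives.

  The obstruction is \<open>linear_type_colon\<close>: since \<open>J = I + (g)\<close>, linear type would give \<open>c g \<in> I\<close> for
  every \<open>c\<close> with \<open>c g\<^sup>2 \<in> I J\<close>. This fails for
  \<open>c = (q\<^sub>0 - q\<^sub>1) (q\<^sub>0 - q\<^sub>2) (q\<^sub>1 - q\<^sub>2) (p\<^sub>1 - p\<^sub>2)\<close>.

  Why \<open>c g\<^sup>2 \<in> I J\<close>: the product of the nine forms is the resultant of the cubics with roots \<open>p\<^sub>i\<close> and
  \<open>q\<^sub>j\<close>, hence a polynomial in the elementary symmetric functions \<open>s2, s3\<close> of \<open>p\<close> and \<open>t2, t3\<close> of \<open>q\<close>.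
  Its derivatives \<open>U, V, U', V'\<close> by these four functions satisfy the quadratic relation
  \<open>3 (U + U')\<^sup>2 + (V + V') (s2 V + t2 V') = 0\<close> (\<open>resultant_partials_relation\<close>). Multiplied by the
  square roots of both discriminants, it becomes a quadratic relation between the partial derivatives
  of \<open>F\<close> in which \<open>g\<^sup>2\<close> has the coefficient \<open>c\<close> (\<open>square_relation\<close>).

  Why \<open>c g \<notin> I\<close>: otherwise there is a derivation \<open>\<delta>\<close> with \<open>\<delta> F = 0\<close> and \<open>\<delta> p\<^sub>0 = c\<close>. From \<open>\<delta> F = 0\<close> it
  follows that \<open>\<delta>\<close> is tangent to each hyperplane: \<open>\<delta> p\<^sub>i\<close> and \<open>\<delta> q\<^sub>j\<close> agree where \<open>p\<^sub>i = q\<^sub>j\<close>. Comparing a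
  single coefficient of the terms of degree four along nine planes, one in each hyperplane
  \<open>p\<^sub>i = q\<^sub>j\<close>, and summing cancels everything except this coefficient of \<open>\<delta> p\<^sub>0\<close>, which is therefore
  zero. For \<open>c\<close> it is not (\<open>alternant_not_log_derivative\<close>).
\<close>

section \<open>Derivations of polynomial rings\<close>

locale derivation =
  fixes d :: "'a::comm_ring_1 \<Rightarrow> 'a"
  assumes add: "d (x + y) = d x + d y" and mult: "d (x * y) = d x * y + x * d y"
begin

lemma zero: "d 0 = 0"
  using add[of 0 0] by simp

lemma one: "d 1 = 0"
  using mult[of 1 1] by simp

lemma uminus: "d (- x) = - d x"
  using add[of x "- x"] by (simp add: zero eq_neg_iff_add_eq_0 add.commute)

lemma diff: "d (x - y) = d x - d y"
  using add[of x "- y"] by (simp add: uminus)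

lemma of_nat: "d (of_nat n) = 0"
  by (induction n) (simp_all add: zero one add)

lemma numeral: "d (numeral n) = 0"
  using of_nat[of "numeral n"] by simp

lemmas rules = zero one uminus diff add mult numeral

end

lemma single_eq_Const_times_Vars:
  "Poly_Mapping.single m a = Const a * (\<Prod>i\<in>Poly_Mapping.keys m. Var i ^ Poly_Mapping.lookup m i)"
proof -
  have pw: "Var i ^ k = (Poly_Mapping.single (Poly_Mapping.single i k) 1 :: ('a, 'b) mpoly)" for i k
    by (induction k) (simp_all add: Var_def mult_single flip: single_add)
  have pr: "(\<Prod>i\<in>T. Poly_Mapping.single (h i) 1) =
      (Poly_Mapping.single (\<Sum>i\<in>T. h i) 1 :: ('a, 'b) mpoly)" if "finite T" for T h
    using that by induction (simp_all add: mult_single)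
  have "(\<Sum>i\<in>Poly_Mapping.keys m. Poly_Mapping.single i (Poly_Mapping.lookup m i)) = m"
    by (rule poly_mapping_eqI)
      (simp add: lookup_sum lookup_single when_def in_keys_iff sum.delta cong: if_cong)
  then show ?thesis by (simp add: pw pr Const_def mult_single)
qed

text \<open>
  Identities between ring homomorphisms and derivations only have to be checked on constants and
  variables; this rule replaces computations with exponent vectors.
\<close>

lemma mpoly_generator_induct [case_names Const Var add mult]:
  fixes p :: "('v, 'a::comm_ring_1) mpoly"
  assumes C: "\<And>a. P (Const a)" and V: "\<And>i. P (Var i)"
    and A: "\<And>p q. P p \<Longrightarrow> P q \<Longrightarrow> P (p + q)" and M: "\<And>p q. P p \<Longrightarrow> P q \<Longrightarrow> P (p * q)"
  shows "P p"
proof (induction p rule: mpoly_induct)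
  case (single m a)
  have one: "P 1" using C[of 1] by (simp add: Const_def)
  have pw: "P (Var i ^ k)" for i k by (induction k) (auto intro: one V M)
  have "P (\<Prod>i\<in>T. Var i ^ k i)" if "finite T" for T k
    using that by induction (auto intro: one pw M)
  then show ?case by (simp add: single_eq_Const_times_Vars C M)
qed (rule A)

lemma pdiff_superset:
  assumes "finite T" "Poly_Mapping.keys p \<subseteq> T"
  shows "pdiff i p = (\<Sum>m\<in>T. Poly_Mapping.single (m - Poly_Mapping.single i 1)
        (of_nat (Poly_Mapping.lookup m i) * Poly_Mapping.lookup p m))"
  unfolding pdiff_def
  by (rule sum.mono_neutral_left) (use assms in \<open>auto simp: in_keys_iff\<close>)

lemma pdiff_add: "pdiff i (p + q) = pdiff i p + pdiff i q"
proof -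
  let ?T = "Poly_Mapping.keys p \<union> Poly_Mapping.keys q"
  have "Poly_Mapping.keys (p + q) \<subseteq> ?T" by (rule keys_add)
  then show ?thesis
    by (subst (1 2 3) pdiff_superset[of ?T])
      (auto simp: lookup_add distrib_left single_add sum.distrib)
qed

lemma pdiff_single: "pdiff i (Poly_Mapping.single m a) =
    Poly_Mapping.single (m - Poly_Mapping.single i 1) (of_nat (Poly_Mapping.lookup m i) * a)"
  by (subst pdiff_superset[of "{m}"]) auto

lemma pdiff_mult: "pdiff i (p * q) = pdiff i p * q + p * pdiff i q"
proof (induction p rule: mpoly_induct)
  case (single m a)
  show ?case
  proof (induction q rule: mpoly_induct)
    case (single n b)
    have shift: "Poly_Mapping.single (k - Poly_Mapping.single i 1 + l) (of_nat (Poly_Mapping.lookup k i) * c) =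
        Poly_Mapping.single (k + l - Poly_Mapping.single i 1) (of_nat (Poly_Mapping.lookup k i) * c)"
      for k l and c :: 'b
    proof (cases "Poly_Mapping.lookup k i = 0")
      case False
      then have "k - Poly_Mapping.single i 1 + l = k + l - Poly_Mapping.single i 1"
        by (intro poly_mapping_eqI) (auto simp: lookup_add lookup_minus lookup_single when_def)
      then show ?thesis by simp
    qed simp
    have "pdiff i (Poly_Mapping.single m a * Poly_Mapping.single n b) =
        Poly_Mapping.single (m + n - Poly_Mapping.single i 1) (of_nat (Poly_Mapping.lookup m i) * (a * b)) +
        Poly_Mapping.single (n + m - Poly_Mapping.single i 1) (of_nat (Poly_Mapping.lookup n i) * (a * b))"
      by (simp add: mult_single pdiff_single lookup_add distrib_right single_add add.commute[of n])
    also have "\<dots> = pdiff i (Poly_Mapping.single m a) * Poly_Mapping.single n b +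
        Poly_Mapping.single m a * pdiff i (Poly_Mapping.single n b)"
      unfolding shift[of m n, symmetric] shift[of n m, symmetric]
      by (simp add: pdiff_single mult_single ac_simps)
    finally show ?case .
  qed (simp add: distrib_left pdiff_add)
qed (simp add: distrib_right pdiff_add)

context coeff_hom
begin

lemma meval_zero: "meval \<phi> \<xi> 0 = 0"
  using meval_diff[of \<xi> 0 0] by simp

lemma meval_sum: "meval \<phi> \<xi> (sum h T) = (\<Sum>t\<in>T. meval \<phi> \<xi> (h t))"
  by (induction T rule: infinite_finite_induct) (simp_all add: meval_zero meval_add)

lemma meval_prod: "meval \<phi> \<xi> (prod h T) = (\<Prod>t\<in>T. meval \<phi> \<xi> (h t))"
  by (induction T rule: infinite_finite_induct) (simp_all add: meval_one meval_mult)

lemma meval_prod_list: "meval \<phi> \<xi> (prod_list ps) = prod_list (map (meval \<phi> \<xi>) ps)"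
  by (induction ps) (simp_all add: meval_one meval_mult)

lemmas meval_rules = meval_add meval_diff meval_uminus meval_mult meval_Const meval_Var meval_one
  meval_zero meval_sum meval_prod meval_prod_list

end

interpretation pdiff: derivation "pdiff i" for i
  by unfold_locales (rule pdiff_add pdiff_mult)+

lemma pdiff_Const: "pdiff i (Const a) = 0"
  by (simp add: Const_def pdiff_single)

lemma pdiff_Var: "pdiff i (Var j) = (if i = j then 1 else 0)"
  by (simp add: Var_def pdiff_single lookup_single)

lemma pdiff_commute: "pdiff i (pdiff j p) = pdiff j (pdiff i p)"
  by (induction p rule: mpoly_generator_induct)
    (auto simp: pdiff_Const pdiff_Var pdiff.rules)

text \<open>
  The chain rule for a substitution of univariate polynomials. Iterating the univariate derivative
  after restriction to a line thus computes iterated directional derivatives.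
\<close>

lemma pderiv_meval:
  fixes \<phi> :: "'a::comm_ring_1 \<Rightarrow> 'b::idom poly" and g :: "('v::finite, 'a) mpoly"
  assumes "coeff_hom \<phi>" "\<And>a. pderiv (\<phi> a) = 0"
  shows "pderiv (meval \<phi> \<xi> g) = (\<Sum>i\<in>UNIV. meval \<phi> \<xi> (pdiff i g) * pderiv (\<xi> i))"
proof -
  interpret coeff_hom \<phi> by fact
  show ?thesis
  proof (induction g rule: mpoly_generator_induct)
    case (Var j)
    then show ?case
      by (simp add: pdiff_Var meval_Var meval_zero meval_one if_distrib[of "meval _ _"] if_distrib[of "\<lambda>x. x * _"] cong: if_cong)
  qed (simp_all add: meval_Const pdiff_Const meval_zero assms meval_add meval_mult pdiff.rules pderiv_add
      pderiv_mult sum.distrib sum_distrib_left algebra_simps)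
qed

interpretation ident: coeff_hom "\<lambda>a::'a::comm_ring_1. a"
  by unfold_locales simp_all

interpretation pCons00: coeff_hom "\<lambda>a::'a::comm_ring_1. [:[:a:]:]"
  by unfold_locales (simp_all add: one_pCons)

lemma poly_meval:
  assumes "coeff_hom \<phi>"
  shows "poly (meval (\<lambda>a. [:\<phi> a:]) \<xi> g) z = meval \<phi> (\<lambda>i. poly (\<xi> i) z) g"
proof -
  interpret coeff_hom \<phi> by fact
  interpret C: coeff_hom "\<lambda>a. [:\<phi> a:]"
    by unfold_locales (simp_all add: one add mult one_pCons)
  show ?thesis
    by (induction g rule: mpoly_generator_induct)
      (simp_all add: meval_Const meval_Var meval_add meval_mult
        C.meval_Const C.meval_Var C.meval_add C.meval_mult)
qed

definition dir_deriv :: "('v::finite \<Rightarrow> 'a::comm_ring_1) \<Rightarrow> ('v, 'a) mpoly \<Rightarrow> ('v, 'a) mpoly"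
  where "dir_deriv v g = (\<Sum>i\<in>UNIV. Const (v i) * pdiff i g)"

interpretation dir_deriv: derivation "dir_deriv v" for v
  by unfold_locales
    (simp_all add: dir_deriv_def pdiff.rules distrib_left distrib_right sum.distrib
      sum_distrib_left sum_distrib_right algebra_simps)

text \<open>
  The polynomial \<open>g\<close> is restricted to the affine plane of the points \<open>c + s a + h b\<close>, as a polynomial in
  \<open>s\<close> over the polynomials in \<open>h\<close>. The derivative in the conclusion is \<open>6\<close> times the coefficient of
  \<open>s h\<^sup>3\<close>. As an iterated derivative it is visibly linear in \<open>a\<close> and symmetric in the four directions.
\<close>

lemma vanishing_on_plane_imp_mixed_deriv_zero:
  fixes g :: "('v::finite, 'k::field) mpoly"
  assumes "meval (\<lambda>a. [:[:a:]:]) (\<lambda>i. [:[:c i, b i:], [:a i:]:]) g = 0"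
  shows "meval (\<lambda>a. a) c (dir_deriv b (dir_deriv b (dir_deriv b (dir_deriv a g)))) = 0"
proof -
  \<comment> \<open>differentiate once by \<open>s\<close> and put \<open>s = 0\<close>, then three times by \<open>h\<close> and put \<open>h = 0\<close>\<close>
  have "pderiv (meval (\<lambda>a. [:[:a:]:]) (\<lambda>i. [:[:c i, b i:], [:a i:]:]) g) =
      meval (\<lambda>a. [:[:a:]:]) (\<lambda>i. [:[:c i, b i:], [:a i:]:]) (dir_deriv a g)"
    by (subst pderiv_meval)
      (simp_all add: pCons00.coeff_hom_axioms pderiv_pCons dir_deriv_def
        pCons00.meval_rules mult_ac)
  then have "poly (meval (\<lambda>a. [:[:a:]:]) (\<lambda>i. [:[:c i, b i:], [:a i:]:]) (dir_deriv a g)) 0 = 0"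
    using assms by simp
  then have z: "meval (\<lambda>a. [:a:]) (\<lambda>i. [:c i, b i:]) (dir_deriv a g) = 0"
    by (subst (asm) poly_meval) (simp_all add: pCons0.coeff_hom_axioms)
  have st: "pderiv (meval (\<lambda>a. [:a:]) (\<lambda>i. [:c i, b i:]) h) =
      meval (\<lambda>a. [:a:]) (\<lambda>i. [:c i, b i:]) (dir_deriv b h)" for h
    by (subst pderiv_meval)
      (simp_all add: pCons0.coeff_hom_axioms pderiv_pCons dir_deriv_def
        pCons0.meval_rules mult_ac)
  have "meval (\<lambda>a. [:a:]) (\<lambda>i. [:c i, b i:]) (dir_deriv b (dir_deriv b (dir_deriv b (dir_deriv a g)))) = 0"
    unfolding st[symmetric] z by simp
  from arg_cong[OF this, of "\<lambda>p. poly p 0"] show ?thesis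
    using poly_meval[OF ident.coeff_hom_axioms, of "\<lambda>i. [:c i, b i:]"] by simp
qed

lemma Const_0 [simp]: "Const 0 = 0" and Const_1 [simp]: "Const 1 = 1"
  by (simp_all add: Const_def)

lemma Const_uminus [simp]: "Const (- a) = - Const a"
  by (simp add: Const_def single_uminus)

lemma Const_numeral [simp]: "Const (numeral n) = numeral n"
proof -
  have "Const (of_nat m) = of_nat m" for m
    by (induction m) (simp_all add: Const_def single_add)
  from this[of "numeral n"] show ?thesis by simp
qed

lemma (in coeff_hom) meval_numeral: "meval \<phi> \<xi> (numeral n) = numeral n"
proof -
  have "meval \<phi> \<xi> (of_nat m) = of_nat m" for m
    by (induction m) (simp_all add: meval_rules)
  from this[of "numeral n"] show ?thesis by simp
qed

lemma (in derivation) prod_list_const: "\<forall>x\<in>set ys. d x = 0 \<Longrightarrow> d (prod_list ys) = 0"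
  by (induction ys) (simp_all add: one mult)

lemma derivation_sum: "derivation (\<lambda>g. \<Sum>i\<in>T. \<theta> i * pdiff i g)"
  by unfold_locales (simp_all add: pdiff.rules sum.distrib sum_distrib_left sum_distrib_right algebra_simps)

section \<open>Ideals of linear type\<close>

lemma ideal_ring_on_UNIV_iff:
  "ideal I (ring_on UNIV) \<longleftrightarrow>
    0 \<in> I \<and> (\<forall>x\<in>I. \<forall>y\<in>I. x + y \<in> I) \<and> (\<forall>r. \<forall>x\<in>I. r * x \<in> I)"
proof (intro iffI conjI)
  assume I: "ideal I (ring_on UNIV)"
  interpret ideal I "ring_on UNIV" by fact
  show "0 \<in> I" using additive_subgroup.zero_closed[OF additive_subgroup_axioms] by (simp add: ring_on_def)
  show "\<forall>x\<in>I. \<forall>y\<in>I. x + y \<in> I"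
    using additive_subgroup.a_closed[OF additive_subgroup_axioms] by (simp add: ring_on_def)
  show "\<forall>r. \<forall>x\<in>I. r * x \<in> I" using I_l_closed by (simp add: ring_on_def)
next
  interpret cring "ring_on UNIV" by (rule cring_ring_on_UNIV)
  assume I: "0 \<in> I \<and> (\<forall>x\<in>I. \<forall>y\<in>I. x + y \<in> I) \<and> (\<forall>r. \<forall>x\<in>I. r * x \<in> I)"
  then have neg: "- x \<in> I" if "x \<in> I" for x using that by (metis mult_minus1)
  show "ideal I (ring_on UNIV)"
  proof (rule idealI)
    show "subgroup I (add_monoid (ring_on UNIV))"
    proof (rule add.subgroupI)
      show "\<ominus>\<^bsub>ring_on UNIV\<^esub> a \<in> I" if "a \<in> I" for a
        using neg[OF that] by (simp add: ring_on_a_inv[OF cring_ring_on_UNIV])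
    qed (use I in \<open>auto simp: ring_on_def\<close>)
    show "x \<otimes>\<^bsub>ring_on UNIV\<^esub> a \<in> I" "a \<otimes>\<^bsub>ring_on UNIV\<^esub> x \<in> I" if "a \<in> I" for a x
      using I that by (simp_all add: ring_on_def mult.commute[of a])
  qed (rule ring_axioms)
qed

lemma
  assumes I: "ideal I (ring_on UNIV)"
  shows ideal_uminus: "x \<in> I \<Longrightarrow> - x \<in> I"
    and ideal_diff: "x \<in> I \<Longrightarrow> y \<in> I \<Longrightarrow> x - y \<in> I"
proof -
  have neg: "- x \<in> I" if "x \<in> I" for x
    using I that unfolding ideal_ring_on_UNIV_iff by (metis mult_minus1)
  then show "x \<in> I \<Longrightarrow> - x \<in> I" .
  show "x - y \<in> I" if "x \<in> I" "y \<in> I"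
    using I that(1) neg[OF that(2)] unfolding ideal_ring_on_UNIV_iff diff_conv_add_uminus by blast
qed

lemma ideal_combinations:
  fixes f :: "'i \<Rightarrow> 'a::comm_ring_1"
  shows "ideal (range (\<lambda>k. \<Sum>i\<in>S. k i * f i)) (ring_on UNIV)"
  unfolding ideal_ring_on_UNIV_iff
proof (intro conjI ballI allI)
  show "0 \<in> range (\<lambda>k. \<Sum>i\<in>S. k i * f i)" by (rule range_eqI[of _ _ "\<lambda>_. 0"]) simp
  fix x assume "x \<in> range (\<lambda>k. \<Sum>i\<in>S. k i * f i)"
  then obtain k where k: "x = (\<Sum>i\<in>S. k i * f i)" by auto
  show "r * x \<in> range (\<lambda>k. \<Sum>i\<in>S. k i * f i)" for r
    by (rule range_eqI[of _ _ "\<lambda>i. r * k i"]) (simp add: k sum_distrib_left mult_ac)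
  fix y assume "y \<in> range (\<lambda>k. \<Sum>i\<in>S. k i * f i)"
  then obtain l where l: "y = (\<Sum>i\<in>S. l i * f i)" by auto
  show "x + y \<in> range (\<lambda>k. \<Sum>i\<in>S. k i * f i)"
    by (rule range_eqI[of _ _ "\<lambda>i. k i + l i"]) (simp add: k l distrib_right sum.distrib)
qed

lemma generator_in_combinations:
  fixes f :: "'i \<Rightarrow> 'a::comm_ring_1"
  assumes "finite S" "i \<in> S"
  shows "f i \<in> range (\<lambda>k. \<Sum>j\<in>S. k j * f j)"
  by (rule range_eqI[of _ _ "\<lambda>j. if j = i then 1 else 0"])
    (use assms in \<open>simp add: if_distrib[of "\<lambda>x. x * _"] cong: if_cong\<close>)

lemma genideal_image_eq:
  fixes f :: "'i::finite \<Rightarrow> 'a::comm_ring_1"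
  shows "genideal (ring_on UNIV) (range f) = range (\<lambda>k. \<Sum>i\<in>UNIV. k i * f i)"
proof (intro antisym subsetI)
  interpret cring "ring_on UNIV" by (rule cring_ring_on_UNIV)
  have gen: "ideal (genideal (ring_on UNIV) (range f)) (ring_on UNIV)"
    by (rule genideal_ideal) (simp add: ring_on_def)
  show "x \<in> genideal (ring_on UNIV) (range f)" if "x \<in> range (\<lambda>k. \<Sum>i\<in>UNIV. k i * f i)" for x
  proof -
    have f: "f i \<in> genideal (ring_on UNIV) (range f)" for i
      using genideal_self[of "range f"] by (auto simp: ring_on_def)
    have "(\<Sum>i\<in>T. k i * f i) \<in> genideal (ring_on UNIV) (range f)" if "finite T" for T k
      using that gen f by induction (auto simp: ideal_ring_on_UNIV_iff)
    then show ?thesis using that by auto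
  qed
  have "range f \<subseteq> range (\<lambda>k. \<Sum>i\<in>UNIV. k i * f i)"
    by (intro image_subsetI generator_in_combinations) simp_all
  then show "x \<in> range (\<lambda>k. \<Sum>i\<in>UNIV. k i * f i)" if "x \<in> genideal (ring_on UNIV) (range f)" for x
    using genideal_minimal[OF ideal_combinations, of "range f"] that by blast
qed

text \<open>
  If the symmetric algebra of \<open>J\<close> is the Rees algebra, the relation \<open>c g\<^sup>2 = \<Sum> u v\<close> already holds in the
  former. Killing the elements of \<open>I\<close> there leaves the symmetric algebra of the cyclic module \<open>J/I\<close>, which is
  isomorphic to \<open>A/(I : g)\<close> with \<open>A\<close> the ambient ring. All components of positive degree of that algebra
  are copies of \<open>A/(I : g)\<close>, so \<open>c g\<^sup>2 = 0\<close> forces \<open>c \<in> (I : g)\<close>.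
\<close>

lemma linear_type_colon:
  fixes J I :: "'a::comm_ring_1 set"
  assumes lt: "linear_type J" and J: "ideal J (ring_on UNIV)" and I: "ideal I (ring_on UNIV)"
    and sub: "I \<subseteq> J" and g: "g \<in> J" and gen: "\<And>h. h \<in> J \<Longrightarrow> \<exists>r. h - r * g \<in> I"
    and u: "\<And>t. t \<in> T \<Longrightarrow> u t \<in> I" and v: "\<And>t. t \<in> T \<Longrightarrow> v t \<in> J" and "finite T"
    and rel: "c * g * g = (\<Sum>t\<in>T. u t * v t)"
  shows "c * g \<in> I"
proof -
  note I_closed = I[unfolded ideal_ring_on_UNIV_iff] ideal_uminus[OF I] ideal_diff[OF I]
  define p :: "('a, 'a) mpoly" where "p = Const c * Var g * Var g - (\<Sum>t\<in>T. Var (u t) * Var (v t))"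
  have uJ: "u t \<in> J" if "t \<in> T" for t using u[OF that] sub by auto
  have zero_in: "0 \<in> mpolys_in J" by (simp add: mpolys_in_def)
  have sum_in: "(\<Sum>t\<in>S. Var (u t) * Var (v t)) \<in> mpolys_in J" if "finite S" "S \<subseteq> T" for S
    using that by induction (auto intro!: mpolys_in_add mpolys_in_mult Var_in uJ v zero_in)
  have p_in: "p \<in> mpolys_in J"
    unfolding p_def
    by (intro mpolys_in_diff mpolys_in_mult Const_in Var_in g sum_in assms(9) order_refl)
  have rz: "rees_eval 0 = 0" using rees_eval_simps(2)[of 0 0] by simp
  have "rees_eval (\<Sum>t\<in>S. Var (u t) * Var (v t)) = Polynomial.monom (\<Sum>t\<in>S. u t * v t) 2"
    if "finite S" for S
    using that
    by induction (simp_all add: rees_eval_simps rz mult_monom add_monom numeral_2_eq_2)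
  then have "rees_eval p = 0"
    using rel \<open>finite T\<close>
    by (simp add: p_def rees_eval_simps smult_monom mult_monom numeral_2_eq_2)
  then have "sym_to_rees (sym_ideal J +>\<^bsub>ring_on (mpolys_in J)\<^esub> p) =
      sym_to_rees (sym_ideal J +>\<^bsub>ring_on (mpolys_in J)\<^esub> 0)"
    by (simp add: sym_to_rees_coset[OF J] rz)
  moreover have "inj_on sym_to_rees (carrier (sym_algebra J))"
    using lt by (simp add: linear_type_def)
  ultimately have coset: "sym_ideal J +>\<^bsub>ring_on (mpolys_in J)\<^esub> p = sym_ideal J +>\<^bsub>ring_on (mpolys_in J)\<^esub> 0"
    using p_in zero_in by (auto simp: carrier_sym_algebra dest!: inj_onD)
  interpret S: ideal "sym_ideal J" "ring_on (mpolys_in J)" by (rule ideal_sym_ideal[OF J])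
  have "0 \<in> sym_ideal J"
    using additive_subgroup.zero_closed[OF S.additive_subgroup_axioms] by (simp add: ring_on_def)
  with coset have p_sym: "p \<in> sym_ideal J"
    by (force simp: a_r_coset_def r_coset_def ring_on_def)

  \<comment> \<open>Sending the variable of \<open>h\<close> to a coefficient \<open>\<rho> h\<close> with \<open>h \<equiv> \<rho> h g\<close> modulo \<open>I\<close> is linear modulo the
    ideal \<open>(I : g)\<close>, so it maps the defining ideal of the symmetric algebra into \<open>(I : g)\<close>.\<close>
  define \<rho> where "\<rho> h = (SOME r. h - r * g \<in> I)" for h
  have \<rho>: "h - \<rho> h * g \<in> I" if "h \<in> J" for h
    unfolding \<rho>_def using someI_ex[OF gen[OF that]] .
  let ?E = "meval (\<lambda>a. a) \<rho>"
  note E = ident.meval_rules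
  let ?K = "{q \<in> mpolys_in J. ?E q * g \<in> I}"
  interpret P: cring "ring_on (mpolys_in J)" by (rule cring_mpolys_in)
  have "ideal ?K (ring_on (mpolys_in J))"
  proof (rule idealI)
    show "subgroup ?K (add_monoid (ring_on (mpolys_in J)))"
    proof (rule P.add.subgroupI)
      show "\<ominus>\<^bsub>ring_on (mpolys_in J)\<^esub> q \<in> ?K" if "q \<in> ?K" for q
        using that I_closed by (simp add: ring_on_a_inv[OF cring_mpolys_in] mpolys_in_uminus E)
      show "?K \<noteq> {}" using zero_in I_closed by (auto simp: E)
    qed (use I_closed in \<open>auto simp: ring_on_def E distrib_right mpolys_in_add\<close>)
    show "r \<otimes>\<^bsub>ring_on (mpolys_in J)\<^esub> q \<in> ?K" "q \<otimes>\<^bsub>ring_on (mpolys_in J)\<^esub> r \<in> ?K"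
      if "q \<in> ?K" "r \<in> carrier (ring_on (mpolys_in J))" for q r
    proof -
      have "?E r * (?E q * g) \<in> I" using that I_closed(1) by blast
      then have "?E (r * q) * g \<in> I" "?E (q * r) * g \<in> I" by (simp_all add: E mult_ac)
      then show "r \<otimes>\<^bsub>ring_on (mpolys_in J)\<^esub> q \<in> ?K" "q \<otimes>\<^bsub>ring_on (mpolys_in J)\<^esub> r \<in> ?K"
        using that by (simp_all add: ring_on_def mpolys_in_mult)
    qed
  qed (rule P.ring_axioms)
  moreover have "sym_relations J \<subseteq> ?K"
  proof
    fix q assume q: "q \<in> sym_relations J"
    then have "q \<in> mpolys_in J" using sym_relations_in[OF J] by auto
    moreover have "?E q * g \<in> I"
      using q unfolding sym_relations_def
    proof (elim UnE CollectE exE conjE)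
      fix h k assume q: "q = Var (h + k) - Var h - Var k" and hk: "h \<in> J" "k \<in> J"
      then have "h + k \<in> J" using J by (simp add: ideal_ring_on_UNIV_iff)
      from I_closed(3)[OF I_closed(3)[OF \<rho>[OF hk(1)] I_closed(2)[OF \<rho>[OF hk(2)]]] \<rho>[OF this]]
      show "?E q * g \<in> I" by (simp add: q E algebra_simps)
    next
      fix a h assume q: "q = Var (a * h) - Const a * Var h" and h: "h \<in> J"
      then have "a * h \<in> J" "a * (h - \<rho> h * g) \<in> I"
        using J I_closed(1) \<rho>[OF h] by (simp_all add: ideal_ring_on_UNIV_iff)
      from I_closed(3)[OF this(2) \<rho>[OF this(1)]]
      show "?E q * g \<in> I" by (simp add: q E algebra_simps)
    qed
    ultimately show "q \<in> ?K" by simp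
  qed
  ultimately have "sym_ideal J \<subseteq> ?K"
    unfolding sym_ideal_def by (rule P.genideal_minimal)
  with p_sym have Ep: "?E p * g \<in> I" by auto
  have ug: "\<rho> (u t) * g \<in> I" if "t \<in> T" for t
    using I_closed(3)[OF u[OF that] \<rho>[OF uJ[OF that]]] by simp
  have "?E (\<Sum>t\<in>S. Var (u t) * Var (v t)) * g \<in> I" if "finite S" "S \<subseteq> T" for S
    using that
  proof induction
    case (insert t S)
    have "\<rho> (v t) * (\<rho> (u t) * g) \<in> I" using insert ug I_closed(1) by auto
    moreover have "?E (\<Sum>t\<in>S. Var (u t) * Var (v t)) * g \<in> I"
      using insert.IH insert.prems by blast
    ultimately have "\<rho> (v t) * (\<rho> (u t) * g) + ?E (\<Sum>t\<in>S. Var (u t) * Var (v t)) * g \<in> I"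
      using I_closed(1) by blast
    then show ?case using insert by (simp add: E algebra_simps)
  qed (use I_closed(1) in \<open>simp add: E\<close>)
  from this[OF \<open>finite T\<close>] have "?E (\<Sum>t\<in>T. Var (u t) * Var (v t)) * g \<in> I" by simp
  with Ep have "?E p * g + ?E (\<Sum>t\<in>T. Var (u t) * Var (v t)) * g \<in> I"
    using I_closed(1) by blast
  \<comment> \<open>\<open>\<rho> g\<close> need not be \<open>1\<close>, but it acts on \<open>g\<close> like \<open>1\<close> modulo \<open>I\<close>\<close>
  then have 1: "c * \<rho> g * \<rho> g * g \<in> I" by (simp add: p_def E algebra_simps)
  moreover have "c * \<rho> g * (g - \<rho> g * g) \<in> I" and 2: "c * (g - \<rho> g * g) \<in> I"
    using I_closed(1) \<rho>[OF g] by blast+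
  ultimately have "c * \<rho> g * \<rho> g * g + c * \<rho> g * (g - \<rho> g * g) \<in> I"
    using I_closed(1) by blast
  with 2 have "(c * \<rho> g * \<rho> g * g + c * \<rho> g * (g - \<rho> g * g)) + c * (g - \<rho> g * g) \<in> I"
    using I_closed(1) by blast
  then show ?thesis by (simp add: algebra_simps)
qed

section \<open>A quadratic relation between the partial derivatives of a resultant\<close>

text \<open>
  The nine factors are the differences of the roots \<open>a, b, - a - b\<close> of \<open>X\<^sup>3 + s2 X - s3\<close> and the roots
  \<open>c, d, - c - d\<close> of \<open>X\<^sup>3 + t2 X - t3\<close>. The difference of the two cubics is the linear polynomial
  \<open>(s2 - t2) X - (s3 - t3)\<close>, so the second cubic takes the value \<open>(s3 - t3) - (s2 - t2) r\<close> at a root \<open>r\<close>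
  of the first.
\<close>

lemma prod_differences_eq_resultant:
  fixes a b c d :: "'a::comm_ring_1"
  defines "s2 \<equiv> a * b - (a + b)^2" and "s3 \<equiv> - (a * b * (a + b))"
    and "t2 \<equiv> c * d - (c + d)^2" and "t3 \<equiv> - (c * d * (c + d))"
  shows "(a - c) * (a - d) * (a - (- c - d)) * ((b - c) * (b - d) * (b - (- c - d))) *
    ((- a - b - c) * (- a - b - d) * (- a - b - (- c - d))) =
    (s3 - t3)^3 + s2 * (s2 - t2)^2 * (s3 - t3) - s3 * (s2 - t2)^3"
proof -
  have *: "(a - c) * (a - d) * (a - (- c - d)) = (s3 - t3) - (s2 - t2) * a"
   "(b - c) * (b - d) * (b - (- c - d)) = (s3 - t3) - (s2 - t2) * b"
   "(- a - b - c) * (- a - b - d) * (- a - b - (- c - d)) = (s3 - t3) - (s2 - t2) * (- a - b)"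
    unfolding s2_def s3_def t2_def t3_def by (simp_all add: algebra_simps power2_eq_square power3_eq_cube)
  have "(B - A * a) * (B - A * b) * (B - A * (- a - b)) = B^3 + s2 * A^2 * B - s3 * A^3" for A B
    unfolding s2_def s3_def by (simp_all add: algebra_simps power2_eq_square power3_eq_cube)
  then show ?thesis unfolding * .
qed

text \<open>
  Here \<open>U, V, U', V'\<close> are the derivatives of the resultant \<open>B\<^sup>3 + s2 A\<^sup>2 B - s3 A\<^sup>3\<close> by \<open>s2, s3, t2, t3\<close>,
  where \<open>A = s2 - t2\<close> and \<open>B = s3 - t3\<close>. The relation holds because \<open>U + U' = A\<^sup>2 B\<close>, \<open>V + V' = - A\<^sup>3\<close> and
  \<open>s2 V + t2 V' = 3 A B\<^sup>2\<close>.
\<close>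

lemma resultant_partials_relation:
  fixes s2 s3 A B :: "'a::comm_ring_1"
  defines "U \<equiv> A^2 * B + 2 * s2 * A * B - 3 * s3 * A^2" and "V \<equiv> 3 * B^2 + s2 * A^2 - A^3"
  defines "U' \<equiv> 3 * s3 * A^2 - 2 * s2 * A * B" and "V' \<equiv> - 3 * B^2 - s2 * A^2"
  shows "3 * (U + U')^2 + (V + V') * (s2 * V + (s2 - A) * V') = 0"
  unfolding U_def V_def U'_def V'_def by (simp_all add: algebra_simps power2_eq_square power3_eq_cube)

text \<open>
  By the chain rule, a function of \<open>s2\<close> and \<open>s3\<close> with derivatives \<open>U\<close> and \<open>V\<close> has the derivatives \<open>x\<close>
  and \<open>y\<close> by the roots \<open>a\<close> and \<open>b\<close>. Solving for \<open>U\<close> and \<open>V\<close> costs the factor \<open>D\<close>, the square root of the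
  discriminant, because that is the Jacobian determinant of \<open>(s2, s3)\<close>.
\<close>

lemma first_partials_linear:
  fixes a b p U V :: "'a::comm_ring_1"
  defines "p \<equiv> - a - b"
  defines "x \<equiv> (p - a) * (U + b * V)" and "y \<equiv> (p - b) * (U + a * V)"
  defines "D \<equiv> (a - b) * (a - p) * (b - p)"
  shows "a * (p - b) * x - b * (p - a) * y = D * U"
    and "(p - b) * x - (p - a) * y = - D * V"
  unfolding x_def y_def D_def p_def by (simp_all add: algebra_simps)

text \<open>
  For this quadratic form in \<open>U\<close> and \<open>V\<close> a single factor \<open>D\<close> suffices, although solving for \<open>U\<close> and \<open>V\<close>
  separately would cost \<open>D\<^sup>2\<close>.
\<close>

lemma first_partials_quadratic:
  fixes a b p U V :: "'a::comm_ring_1"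
  defines "p \<equiv> - a - b" and "s2 \<equiv> a * b - (a + b)^2"
  defines "x \<equiv> (p - a) * (U + b * V)" and "y \<equiv> (p - b) * (U + a * V)"
  defines "D \<equiv> (a - b) * (a - p) * (b - p)"
  shows "(b - p) * x^2 + 2 * (a - b) * x * y - (a - p) * y^2 = D * (3 * U^2 + s2 * V^2)"
  unfolding x_def y_def D_def p_def s2_def by (simp_all add: algebra_simps power2_eq_square power3_eq_cube)

lemma (in derivation) resultant:
  fixes s2 s3 t2 t3 :: 'a
  defines "A \<equiv> s2 - t2" and "B \<equiv> s3 - t3"
  shows "d (B^3 + s2 * A^2 * B - s3 * A^3) =
    (A^2 * B + 2 * s2 * A * B - 3 * s3 * A^2) * d s2 + (3 * B^2 + s2 * A^2 - A^3) * d s3 +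
    (3 * s3 * A^2 - 2 * s2 * A * B) * d t2 + (- 3 * B^2 - s2 * A^2) * d t3"
  unfolding A_def B_def power2_eq_square power3_eq_cube by (simp add: rules algebra_simps)

text \<open>
  The relation \<open>key\<close>, multiplied by \<open>D D'\<close>, splits into \<open>D' D (3 U\<^sup>2 + s2 V\<^sup>2)\<close>, the analogous term in
  \<open>U'\<close> and \<open>V'\<close>, and the mixed terms \<open>6 (D U) (D' U')\<close> and \<open>(s2 + t2) (D V) (D' V')\<close>. Each of them is a
  quadratic form in the partial derivatives \<open>x, y, z, w\<close>. The term in \<open>x\<^sup>2\<close> is on the left; on the right
  the others are collected behind \<open>y\<close>, \<open>z\<close> and \<open>w\<close>.
\<close>

lemma square_relation:
  fixes a b p c d q U V U' V' s2 t2 :: "'a::comm_ring_1"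
  assumes p: "p = - a - b" and q: "q = - c - d"
    and s2: "s2 = a * b - (a + b)^2" and t2: "t2 = c * d - (c + d)^2"
    and x: "x = (p - a) * (U + b * V)" and y: "y = (p - b) * (U + a * V)"
    and z: "z = (q - c) * (U' + d * V')" and w: "w = (q - d) * (U' + c * V')"
    and D: "D = (a - b) * (a - p) * (b - p)" and D': "D' = (c - d) * (c - q) * (d - q)"
    and key: "3 * (U + U')^2 + (V + V') * (s2 * V + t2 * V') = 0"
  shows "D' * (b - p) * x * x =
    y * (- 2 * D' * (a - b) * x + D' * (a - p) * y) +
    z * (- (q - d) * (p - b) * (6 * a * c + s2 + t2) * x + (q - d) * (p - a) * (6 * b * c + s2 + t2) * y
      - D * (d - q) * z - 2 * D * (c - d) * w) +
    w * ((q - c) * (p - b) * (6 * a * d + s2 + t2) * x - (q - c) * (p - a) * (6 * b * d + s2 + t2) * y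
      + D * (c - q) * w)"
    (is "?l = ?r")
proof -
  let ?DU = "a * (p - b) * x - b * (p - a) * y" and ?DV = "(p - a) * y - (p - b) * x"
  let ?DU' = "c * (q - d) * z - d * (q - c) * w" and ?DV' = "(q - c) * w - (q - d) * z"
  have "?l - ?r = D' * ((b - p) * x^2 + 2 * (a - b) * x * y - (a - p) * y^2) +
      D * ((d - q) * z^2 + 2 * (c - d) * z * w - (c - q) * w^2) +
      6 * (?DU * ?DU') + (s2 + t2) * (?DV * ?DV')"
    by (simp add: algebra_simps power2_eq_square)
  also have "(b - p) * x^2 + 2 * (a - b) * x * y - (a - p) * y^2 = D * (3 * U^2 + s2 * V^2)"
    unfolding x y D s2 p by (rule first_partials_quadratic)
  also have "(d - q) * z^2 + 2 * (c - d) * z * w - (c - q) * w^2 = D' * (3 * U'^2 + t2 * V'^2)"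
    unfolding z w D' t2 q by (rule first_partials_quadratic)
  also have "?DU = D * U"
    unfolding x y D p by (rule first_partials_linear)
  also have "?DU' = D' * U'"
    unfolding z w D' q by (rule first_partials_linear)
  also have "?DV = D * V"
    using first_partials_linear(2)[of a b U V] unfolding x y D p by (simp add: algebra_simps)
  also have "?DV' = D' * V'"
    using first_partials_linear(2)[of c d U' V'] unfolding z w D' q by (simp add: algebra_simps)
  also have "D' * (D * (3 * U^2 + s2 * V^2)) + D * (D' * (3 * U'^2 + t2 * V'^2)) +
      6 * (D * U * (D' * U')) + (s2 + t2) * (D * V * (D' * V')) =
      D * D' * (3 * (U + U')^2 + (V + V') * (s2 * V + t2 * V'))"
    by (simp add: algebra_simps power2_eq_square)
  finally show ?thesis by (simp add: key)
qed

section \<open>Logarithmic derivations of the arrangement\<close>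

definition trace_free :: "'a::comm_ring_1 \<Rightarrow> 'a \<Rightarrow> nat \<Rightarrow> 'a"
  where "trace_free x y i = (if i = 0 then x else if i = 1 then y else - x - y)"

text \<open>
  The triple \<open>(0, 1, -1)\<close>, cyclically rotated so that its zero stands at \<open>j\<close>. Only the indices
  \<open>0, 1, 2\<close> of triples matter.
\<close>

definition root_vec :: "nat \<Rightarrow> nat \<Rightarrow> 'a::comm_ring_1"
  where "root_vec j i = (if i = j then 0 else if i = (j + 1) mod 3 then 1 else - 1)"

definition wt_vec :: "nat \<Rightarrow> nat \<Rightarrow> 'a::comm_ring_1"
  where "wt_vec j i = (if i = j then 2 else - 1)"

text \<open>
  The variables \<open>e1, e2\<close> are the coordinates \<open>p\<^sub>0, p\<^sub>1\<close> and \<open>e3, e4\<close> are \<open>q\<^sub>0, q\<^sub>1\<close>; the list \<open>xs\<close> contains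
  the variables by which \<open>n\<close> exceeds four.
\<close>

locale coordinates =
  fixes e1 e2 e3 e4 :: "'n::finite" and xs :: "'n list"
  assumes dist: "distinct ([e1, e2, e3, e4] @ xs)" and all: "set ([e1, e2, e3, e4] @ xs) = UNIV"
begin

definition P :: "nat \<Rightarrow> ('n, 'k::field_char_0) mpoly"
  where "P = trace_free (Var e1) (Var e2)"

definition Q :: "nat \<Rightarrow> ('n, 'k::field_char_0) mpoly"
  where "Q = trace_free (Var e3) (Var e4)"

text \<open>
  The index \<open>k < 9\<close> encodes the pair \<open>(i, j) = (k div 3, k mod 3)\<close>.
\<close>

definition forms :: "('n, 'k::field_char_0) mpoly list"
  where "forms = map (\<lambda>k. P (k div 3) - Q (k mod 3)) [0..<9] @ map Var xs"

text \<open>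
  The point with prescribed \<open>p\<close> and \<open>q\<close> whose further coordinates all equal \<open>z\<close>. The triples \<open>p\<close> and \<open>q\<close>
  are meant to have sum zero, so that \<open>p 2\<close> and \<open>q 2\<close> are redundant.
\<close>

definition pt :: "(nat \<Rightarrow> 'b) \<Rightarrow> (nat \<Rightarrow> 'b) \<Rightarrow> 'b \<Rightarrow> 'n \<Rightarrow> 'b"
  where "pt p q z i = (if i = e1 then p 0 else if i = e2 then p 1 else
    if i = e3 then q 0 else if i = e4 then q 1 else z)"

lemma neq [simp]: "e1 \<noteq> e2" "e1 \<noteq> e3" "e1 \<noteq> e4" "e2 \<noteq> e3" "e2 \<noteq> e4" "e3 \<noteq> e4"
  "e2 \<noteq> e1" "e3 \<noteq> e1" "e4 \<noteq> e1" "e3 \<noteq> e2" "e4 \<noteq> e2" "e4 \<noteq> e3"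
  "e1 \<notin> set xs" "e2 \<notin> set xs" "e3 \<notin> set xs" "e4 \<notin> set xs"
  using dist by auto

lemma pt_simps [simp]: "pt p q z e1 = p 0" "pt p q z e2 = p 1" "pt p q z e3 = q 0" "pt p q z e4 = q 1"
  "x \<in> set xs \<Longrightarrow> pt p q z x = z"
  by (auto simp: pt_def)

lemma sum_UNIV: "(\<Sum>i\<in>UNIV. h i) = h e1 + h e2 + h e3 + h e4 + (\<Sum>i\<in>set xs. h i)"
  for h :: "'n \<Rightarrow> 'b::comm_monoid_add"
  unfolding all[symmetric] by (simp add: add.assoc)

lemma dir_deriv_pt:
  "dir_deriv (pt p q 0) g = Const (p 0) * pdiff e1 g + Const (p 1) * pdiff e2 g +
    Const (q 0) * pdiff e3 g + Const (q 1) * pdiff e4 g"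
  by (simp add: dir_deriv_def sum_UNIV Const_def)

lemma meval_PQ:
  assumes "coeff_hom \<phi>" and "i < 3"
  shows "p 0 + p 1 + p 2 = 0 \<Longrightarrow> meval \<phi> (pt p q z) (P i) = p i"
    and "q 0 + q 1 + q 2 = 0 \<Longrightarrow> meval \<phi> (pt p q z) (Q i) = q i"
proof -
  interpret coeff_hom \<phi> by fact
  have i: "i = 0 \<or> i = 1 \<or> i = 2" using \<open>i < 3\<close> by auto
  have s: "x = - y - w" if "y + w + x = 0" for x y w :: 'b
    using that by (metis add.commute diff_conv_add_uminus eq_neg_iff_add_eq_0 minus_add_distrib)
  show "meval \<phi> (pt p q z) (P i) = p i" if "p 0 + p 1 + p 2 = 0"
    using i s[OF that] by (auto simp: P_def trace_free_def meval_rules)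
  show "meval \<phi> (pt p q z) (Q i) = q i" if "q 0 + q 1 + q 2 = 0"
    using i s[OF that] by (auto simp: Q_def trace_free_def meval_rules)
qed

lemma meval_form:
  assumes "coeff_hom \<phi>" and "p 0 + p 1 + p 2 = 0" "q 0 + q 1 + q 2 = 0" and "k < 9"
  shows "meval \<phi> (pt p q z) (P (k div 3) - Q (k mod 3)) = p (k div 3) - q (k mod 3)"
  using assms meval_PQ[of \<phi> "k div 3" p q z] meval_PQ[of \<phi> "k mod 3" q p z]
  by (simp add: coeff_hom.meval_diff meval_PQ)

text \<open>
  If \<open>F = l g\<close>, then \<open>\<delta> F = 0\<close> gives \<open>\<delta> l \<cdot> g = - l \<cdot> \<delta> g\<close>. At a point of an integral domain where \<open>l\<close>
  vanishes and no other form does, \<open>g\<close> can be cancelled. The points used later are generic points of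
  planes, with coordinates in an iterated polynomial ring.
\<close>

lemma tangent_to_hyperplane:
  fixes \<delta> :: "('n, 'k::field_char_0) mpoly \<Rightarrow> ('n, 'k) mpoly" and \<phi> :: "'k \<Rightarrow> 'b::idom"
  assumes "derivation \<delta>" and \<delta>: "\<delta> (prod_list forms) = 0" and "coeff_hom \<phi>"
    and pq: "p 0 + p 1 + p 2 = 0" "q 0 + q 1 + q 2 = 0" and "z \<noteq> 0"
    and k: "k < 9" "p (k div 3) = q (k mod 3)"
    and other: "\<And>m. m < 9 \<Longrightarrow> m \<noteq> k \<Longrightarrow> p (m div 3) \<noteq> q (m mod 3)"
  shows "meval \<phi> (pt p q z) (\<delta> (P (k div 3) - Q (k mod 3))) = 0"
proof -
  interpret \<delta>: derivation \<delta> by fact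
  interpret coeff_hom \<phi> by fact
  let ?e = "meval \<phi> (pt p q z)" and ?h = "\<lambda>k. P (k div 3) - Q (k mod 3)"
  define g :: "('n, 'k) mpoly" where "g = (\<Prod>m\<in>{..<9} - {k}. ?h m) * prod_list (map Var xs)"
  have "prod_list (map ?h [0..<9]) = (\<Prod>m\<in>{..<9}. ?h m :: ('n, 'k) mpoly)"
    by (subst prod.distinct_set_conv_list[symmetric]) (simp_all add: atLeast0LessThan)
  then have "prod_list forms = ?h k * g"
    using k(1) by (simp add: forms_def g_def prod.remove[of _ k] mult.assoc)
  then have "?e (\<delta> (?h k * g)) = 0" using \<delta> by (simp add: meval_zero)
  moreover have "?e (?h k) = 0" using k pq meval_form[OF coeff_hom_axioms] by simp
  ultimately have "?e (\<delta> (?h k)) * ?e g = 0"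
    by (simp add: \<delta>.mult meval_add meval_mult)
  moreover have "?e g \<noteq> 0"
  proof -
    have "?e (?h m) \<noteq> 0" if "m < 9" "m \<noteq> k" for m
      using other[OF that] that pq meval_form[OF coeff_hom_axioms] by simp
    then have "(\<Prod>m\<in>{..<9} - {k}. ?e (?h m)) \<noteq> 0" by simp
    moreover have "prod_list (map ?e (map Var xs)) \<noteq> 0"
      using \<open>z \<noteq> 0\<close> by (simp add: prod_list_zero_iff meval_Var image_iff)
    ultimately show ?thesis by (simp add: g_def meval_mult meval_prod meval_prod_list)
  qed
  ultimately show ?thesis by simp
qed

text \<open>
  Up to the factor \<open>6\<close>, the coefficient of \<open>s h\<^sup>3\<close> in \<open>g\<close> at the points \<open>pt 0 0 1 + s a + h b\<close>. The base
  point lies on all nine hyperplanes \<open>p\<^sub>i = q\<^sub>j\<close>, but on none of the added coordinate hyperplanes.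
\<close>

definition quartic_coeff :: "('n \<Rightarrow> 'k) \<Rightarrow> ('n \<Rightarrow> 'k) \<Rightarrow> ('n, 'k::field_char_0) mpoly \<Rightarrow> 'k"
  where "quartic_coeff a b g = meval (\<lambda>a. a) (pt (\<lambda>_. 0) (\<lambda>_. 0) 1)
    (dir_deriv b (dir_deriv b (dir_deriv b (dir_deriv a g))))"

lemma quartic_coeff_add: "quartic_coeff a b (g + h) = quartic_coeff a b g + quartic_coeff a b h"
  by (simp add: quartic_coeff_def dir_deriv.add ident.meval_add)

lemma quartic_coeff_diff: "quartic_coeff a b (g - h) = quartic_coeff a b g - quartic_coeff a b h"
  by (simp add: quartic_coeff_def dir_deriv.diff ident.meval_diff)

lemma dir_deriv_plus:
  fixes a b :: "'n \<Rightarrow> 'k::field_char_0"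
  shows "dir_deriv (\<lambda>i. a i + c * b i) g = dir_deriv a g + Const c * dir_deriv b g"
proof -
  have "Const (a i + c * b i) = Const (a i) + Const c * (Const (b i) :: ('n, 'k) mpoly)" for i
    by (simp add: Const_def single_add mult_single)
  then show ?thesis by (simp add: dir_deriv_def sum.distrib distrib_right sum_distrib_left mult.assoc)
qed

lemma dir_deriv_Const: "dir_deriv b (Const c) = 0"
  by (simp add: dir_deriv_def pdiff_Const)

lemma quartic_coeff_plus:
  "quartic_coeff (\<lambda>i. a i + c * a' i) b g = quartic_coeff a b g + c * quartic_coeff a' b g"
  by (simp add: quartic_coeff_def dir_deriv_plus dir_deriv.rules dir_deriv_Const ident.meval_rules)

text \<open>
  With \<open>w\<^sub>j\<close> for the root vectors, the weight vectors are \<open>w\<^sub>2 - w\<^sub>1\<close>, \<open>w\<^sub>0 - w\<^sub>2\<close>, \<open>w\<^sub>1 - w\<^sub>0\<close>. The sum is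
  obtained by applying a linear functional to
  \<open>(w\<^sub>2 - w\<^sub>1) w\<^sub>0\<^sup>3 + (w\<^sub>0 - w\<^sub>2) w\<^sub>1\<^sup>3 + (w\<^sub>1 - w\<^sub>0) w\<^sub>2\<^sup>3\<close> in the fourth symmetric power, an alternating
  expression divisible by \<open>w\<^sub>0 + w\<^sub>1 + w\<^sub>2 = 0\<close>.
\<close>

lemma sum_quartic_coeff_eq_0:
  fixes g :: "('n, 'k::field_char_0) mpoly"
  shows "(\<Sum>j\<in>{0, 1, 2}. quartic_coeff (pt (\<lambda>_. 0) (wt_vec j) 0) (pt (\<lambda>_. 0) (root_vec j) 0) g) = 0"
  by (simp add: quartic_coeff_def dir_deriv_pt wt_vec_def root_vec_def
      pdiff.rules pdiff_commute[of e4 e3] ident.meval_rules ident.meval_numeral)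

definition cubic_alternant :: "('n, 'k::field_char_0) mpoly"
  where "cubic_alternant = (Q 0 - Q 1) * (Q 0 - Q 2) * (Q 1 - Q 2)"

lemma quartic_coeff_value:
  assumes "j \<in> {0, 1, 2}"
  shows "quartic_coeff (pt (root_vec 0) (\<lambda>_. 0) 0) (pt (\<lambda>_. 0) (root_vec j) 0)
    (cubic_alternant * (P 1 - P 2)) = (- 24 :: 'k::field_char_0)"
  using assms
  by (elim insertE emptyE; simp add: quartic_coeff_def cubic_alternant_def P_def Q_def
      trace_free_def dir_deriv_pt root_vec_def pdiff.rules pdiff_Var ident.meval_rules ident.meval_numeral)

text \<open>
  The hypotheses say that the direction plane of \<open>a\<close> and \<open>b\<close> lies in the \<open>k\<close>-th of the nine hyperplanes
  and in no other one, so the generic point of the plane is a legitimate point for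
  \<open>tangent_to_hyperplane\<close>.
\<close>

lemma quartic_coeff_tangent:
  fixes pa pb qa qb :: "nat \<Rightarrow> 'k::field_char_0"
  assumes \<delta>: "derivation \<delta>" "\<delta> (prod_list forms) = 0"
    and "pa 0 + pa 1 + pa 2 = 0" "qa 0 + qa 1 + qa 2 = 0"
    and "pb 0 + pb 1 + pb 2 = 0" "qb 0 + qb 1 + qb 2 = 0"
    and k: "k < 9" "pa (k div 3) = qa (k mod 3)" "pb (k div 3) = qb (k mod 3)"
    and other: "\<And>m. m < 9 \<Longrightarrow> m \<noteq> k \<Longrightarrow> pa (m div 3) \<noteq> qa (m mod 3) \<or> pb (m div 3) \<noteq> qb (m mod 3)"
  shows "quartic_coeff (pt pa qa 0) (pt pb qb 0) (\<delta> (P (k div 3) - Q (k mod 3))) = 0"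
  unfolding quartic_coeff_def
proof (rule vanishing_on_plane_imp_mixed_deriv_zero)
  have eq: "(\<lambda>i. [:[:pt (\<lambda>_. 0) (\<lambda>_. 0) 1 i, pt pb qb 0 i:], [:pt pa qa 0 i:]:]) =
      pt (\<lambda>i. [:[:0, pb i:], [:pa i:]:]) (\<lambda>i. [:[:0, qb i:], [:qa i:]:]) 1"
    by (auto simp: pt_def fun_eq_iff one_pCons)
  show "meval (\<lambda>a. [:[:a:]:])
      (\<lambda>i. [:[:pt (\<lambda>_. 0) (\<lambda>_. 0) 1 i, pt pb qb 0 i:], [:pt pa qa 0 i:]:])
      (\<delta> (P (k div 3) - Q (k mod 3))) = 0"
    unfolding eq
    by (rule tangent_to_hyperplane[OF \<delta>(1,2) pCons00.coeff_hom_axioms])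
      (use assms in \<open>auto simp: add_ac\<close>)
qed

lemma less_9_iff: "m < 9 \<longleftrightarrow> m \<in> {0, 1, 2, 3, 4, 5, 6, 7, 8 :: nat}"
  by auto

text \<open>
  For fixed \<open>j\<close>, take \<open>b = (0, w\<^sub>j)\<close> with \<open>w\<^sub>j\<close> the root vector, and for \<open>a\<close> the three directions
  \<open>(w\<^sub>0, 0)\<close>, \<open>(2 w\<^sub>0, z\<^sub>j)\<close> and \<open>(2 w\<^sub>0, - z\<^sub>j)\<close> with \<open>z\<^sub>j\<close> the weight vector. They lie in \<open>p\<^sub>0 = q\<^sub>j\<close>,
  \<open>p\<^sub>1 = q\<^sub>j\<close> and \<open>p\<^sub>2 = q\<^sub>j\<close> respectively, and the sum of the last two is four times the first. Hence
  subtracting four times the first tangency condition from the sum of the other two eliminates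
  \<open>\<delta> q\<^sub>j\<close>. Since \<open>\<delta> p\<^sub>0 + \<delta> p\<^sub>1 + \<delta> p\<^sub>2 = 0\<close>, the coefficient of \<open>\<delta> p\<^sub>1 - \<delta> p\<^sub>2\<close> in the
  direction \<open>(0, z\<^sub>j)\<close> is six times that of \<open>\<delta> p\<^sub>0\<close> in the direction \<open>(w\<^sub>0, 0)\<close>. The former sum to
  zero over \<open>j\<close>, whereas the latter all equal \<open>- 24\<close>.
\<close>

lemma alternant_not_log_derivative:
  fixes \<delta> :: "('n, 'k::field_char_0) mpoly \<Rightarrow> ('n, 'k) mpoly"
  assumes \<delta>: "derivation \<delta>" "\<delta> (prod_list forms) = 0"
  shows "\<delta> (P 0) \<noteq> cubic_alternant * (P 1 - P 2)"
proof
  assume val: "\<delta> (P 0) = cubic_alternant * (P 1 - P 2)"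
  interpret \<delta>: derivation \<delta> by (rule \<delta>(1))
  define a :: "'n \<Rightarrow> 'k" where "a = pt (root_vec 0) (\<lambda>_. 0) 0"
  define z b :: "nat \<Rightarrow> 'n \<Rightarrow> 'k" where "z j = pt (\<lambda>_. 0) (wt_vec j) 0"
    and "b j = pt (\<lambda>_. 0) (root_vec j) 0" for j
  have P2: "P 2 = - P 0 - (P 1 :: ('n, 'k) mpoly)" by (simp add: P_def trace_free_def)
  have "quartic_coeff (z j) (b j) (\<delta> (P 1) - \<delta> (P 2)) = - 144" if j: "j \<in> {0, 1, 2}" for j
  proof -
    note cf = quartic_coeff_tangent[OF \<delta>]
    have lin: "quartic_coeff (pt (\<lambda>i. 2 * root_vec 0 i) (\<lambda>i. c * wt_vec j i) 0) v g =
        c * quartic_coeff (z j) v g + 2 * quartic_coeff a v g" for c v g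
    proof -
      have "pt (\<lambda>i. 2 * root_vec 0 i) (\<lambda>i. c * wt_vec j i) 0 = (\<lambda>i. (0 + c * z j i) + 2 * a i)"
        by (auto simp: pt_def z_def a_def fun_eq_iff)
      moreover have "quartic_coeff (\<lambda>_. 0) v g = 0"
        by (simp add: quartic_coeff_def dir_deriv_def[of "\<lambda>_. 0"] dir_deriv.zero ident.meval_zero)
      ultimately show ?thesis
        using quartic_coeff_plus[of "\<lambda>i. 0 + c * z j i" 2 a v g]
          quartic_coeff_plus[of "\<lambda>_. 0" c "z j" v g] by simp
    qed
    have 0: "quartic_coeff a (b j) (\<delta> (P 0 - Q j)) = 0"
      using cf[of "root_vec 0" "\<lambda>_. 0" "\<lambda>_. 0" "root_vec j" j] j unfolding a_def b_def less_9_iff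
      by (elim insertE emptyE; force simp: root_vec_def)
    have 1: "quartic_coeff (pt (\<lambda>i. 2 * root_vec 0 i) (\<lambda>i. 1 * wt_vec j i) 0) (b j) (\<delta> (P 1 - Q j)) = 0"
      using cf[of "\<lambda>i. 2 * root_vec 0 i" "\<lambda>i. 1 * wt_vec j i" "\<lambda>_. 0" "root_vec j" "3 + j"] j unfolding b_def less_9_iff
      by (elim insertE emptyE; force simp: root_vec_def wt_vec_def)
    have 2: "quartic_coeff (pt (\<lambda>i. 2 * root_vec 0 i) (\<lambda>i. - 1 * wt_vec j i) 0) (b j) (\<delta> (P 2 - Q j)) = 0"
      using cf[of "\<lambda>i. 2 * root_vec 0 i" "\<lambda>i. - 1 * wt_vec j i" "\<lambda>_. 0" "root_vec j" "6 + j"] j unfolding b_def less_9_iff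
      by (elim insertE emptyE; force simp: root_vec_def wt_vec_def)
    have "\<delta> (P 0) + \<delta> (P 1) + \<delta> (P 2) = \<delta> 0"
      unfolding \<delta>.add[symmetric] by (simp add: P2)
    then have "quartic_coeff a (b j) (\<delta> (P 0) + \<delta> (P 1) + \<delta> (P 2)) = 0"
      by (simp add: \<delta>.zero quartic_coeff_def dir_deriv.zero ident.meval_zero)
    then have 3: "quartic_coeff a (b j) (\<delta> (P 0)) + quartic_coeff a (b j) (\<delta> (P 1)) +
        quartic_coeff a (b j) (\<delta> (P 2)) = 0"
      by (simp add: quartic_coeff_add)
    have 4: "quartic_coeff a (b j) (\<delta> (P 0)) = - 24"
      unfolding val a_def b_def by (rule quartic_coeff_value[OF j])
    \<comment> \<open>\<open>A0, A1, A2, A\<close> are the coefficients of \<open>\<delta> p\<^sub>0, \<delta> p\<^sub>1, \<delta> p\<^sub>2, \<delta> q\<^sub>j\<close> in the direction \<open>a\<close>, and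
      \<open>Z1, Z2, Z\<close> those of \<open>\<delta> p\<^sub>1, \<delta> p\<^sub>2, \<delta> q\<^sub>j\<close> in the direction \<open>z j\<close>\<close>
    have "Z1 - Z2 = 6 * A0"
      if "A0 - A = 0" "(1 * Z1 + 2 * A1) - (1 * Z + 2 * A) = 0"
        "(- 1 * Z2 + 2 * A2) - (- 1 * Z + 2 * A) = 0" "A0 + A1 + A2 = 0" for Z Z1 Z2 A A0 A1 A2 :: 'k
    proof -
      have "Z1 - Z2 = ((1 * Z1 + 2 * A1) - (1 * Z + 2 * A)) + ((- 1 * Z2 + 2 * A2) - (- 1 * Z + 2 * A))
          - 2 * (A0 + A1 + A2) - 4 * (A0 - A) + 6 * A0"
        by (simp add: algebra_simps)
      then show ?thesis unfolding that by simp
    qed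
    from this[OF 0[unfolded \<delta>.diff quartic_coeff_diff] 1[unfolded \<delta>.diff quartic_coeff_diff lin]
        2[unfolded \<delta>.diff quartic_coeff_diff lin] 3]
    show ?thesis by (simp add: quartic_coeff_diff 4)
  qed
  then have "(\<Sum>j\<in>{0, 1, 2}. quartic_coeff (z j) (b j) (\<delta> (P 1) - \<delta> (P 2))) = - 432" by simp
  then show False unfolding z_def b_def sum_quartic_coeff_eq_0 by simp
qed

end

section \<open>The gradient ideal of the arrangement\<close>

context coordinates
begin

lemma PQ_simps: "P 0 = Var e1" "P (Suc 0) = Var e2" "P 2 = - Var e1 - Var e2"
  "Q 0 = Var e3" "Q (Suc 0) = Var e4" "Q 2 = - Var e3 - Var e4"
  by (simp_all add: P_def Q_def trace_free_def)

lemma prod_forms: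
  fixes s2 s3 t2 t3 :: "('n, 'k::field_char_0) mpoly"
  defines "s2 \<equiv> P 0 * P 1 - (P 0 + P 1)^2" and "s3 \<equiv> - (P 0 * P 1 * (P 0 + P 1))"
    and "t2 \<equiv> Q 0 * Q 1 - (Q 0 + Q 1)^2" and "t3 \<equiv> - (Q 0 * Q 1 * (Q 0 + Q 1))"
  shows "prod_list forms = ((s3 - t3)^3 + s2 * (s2 - t2)^2 * (s3 - t3) - s3 * (s2 - t2)^3) *
    prod_list (map Var xs)"
proof -
  have "[0..<9] = [0, 1, 2, 3, 4, 5, 6, 7, 8]" by (simp add: upt_rec)
  then show ?thesis
    unfolding s2_def s3_def t2_def t3_def prod_differences_eq_resultant[symmetric]
    by (simp add: forms_def PQ_simps mult.assoc)
qed

text \<open>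
  The added variables only contribute the factor \<open>E\<close>, a constant for the derivatives by the first four
  variables. Being homogeneous, the quadratic relation survives multiplication by \<open>E\<close>.
\<close>

lemma pdiff_prod_forms:
  fixes s2 s3 t2 t3 :: "('n, 'k::field_char_0) mpoly"
  defines "s2 \<equiv> P 0 * P 1 - (P 0 + P 1)^2" and "s3 \<equiv> - (P 0 * P 1 * (P 0 + P 1))"
    and "t2 \<equiv> Q 0 * Q 1 - (Q 0 + Q 1)^2" and "t3 \<equiv> - (Q 0 * Q 1 * (Q 0 + Q 1))"
  defines "A \<equiv> s2 - t2" and "B \<equiv> s3 - t3" and "E \<equiv> prod_list (map Var xs)"
  defines "U \<equiv> (A^2 * B + 2 * s2 * A * B - 3 * s3 * A^2) * E" and "V \<equiv> (3 * B^2 + s2 * A^2 - A^3) * E"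
  defines "U' \<equiv> (3 * s3 * A^2 - 2 * s2 * A * B) * E" and "V' \<equiv> (- 3 * B^2 - s2 * A^2) * E"
  shows "pdiff e1 (prod_list forms) = (P 2 - P 0) * (U + P 1 * V)"
    and "pdiff e2 (prod_list forms) = (P 2 - P 1) * (U + P 0 * V)"
    and "pdiff e3 (prod_list forms) = (Q 2 - Q 0) * (U' + Q 1 * V')"
    and "pdiff e4 (prod_list forms) = (Q 2 - Q 1) * (U' + Q 0 * V')"
    and "3 * (U + U')^2 + (V + V') * (s2 * V + t2 * V') = 0"
proof -
  have E: "pdiff e E = 0" if "e \<notin> set xs" for e
    unfolding E_def using that by (intro pdiff.prod_list_const) (auto simp: pdiff_Var)
  have d: "pdiff e (prod_list forms) =
      U * pdiff e s2 + V * pdiff e s3 + U' * pdiff e t2 + V' * pdiff e t3" if "e \<notin> set xs" for e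
    unfolding prod_forms s2_def[symmetric] s3_def[symmetric] t2_def[symmetric] t3_def[symmetric] E_def[symmetric]
      pdiff.mult[of e _ E] pdiff.resultant E[OF that] U_def V_def U'_def V'_def A_def B_def
    by (simp add: algebra_simps)
  show "pdiff e1 (prod_list forms) = (P 2 - P 0) * (U + P 1 * V)"
    "pdiff e2 (prod_list forms) = (P 2 - P 1) * (U + P 0 * V)"
    "pdiff e3 (prod_list forms) = (Q 2 - Q 0) * (U' + Q 1 * V')"
    "pdiff e4 (prod_list forms) = (Q 2 - Q 1) * (U' + Q 0 * V')"
    by (simp_all add: d)
      (simp_all add: s2_def s3_def t2_def t3_def PQ_simps pdiff.rules pdiff_Var power2_eq_square algebra_simps)
  have "3 * (U + U')^2 + (V + V') * (s2 * V + t2 * V') = 0 * E^2"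
    unfolding resultant_partials_relation[of A B s2 s3, symmetric] U_def V_def U'_def V'_def
    by (simp add: A_def algebra_simps power2_eq_square)
  then show "3 * (U + U')^2 + (V + V') * (s2 * V + t2 * V') = 0" by simp
qed

lemma gradient_ideal_forms_not_linear_type:
  "\<not> linear_type (gradient_ideal (prod_list forms :: ('n, 'k::field_char_0) mpoly))"
proof
  let ?F = "prod_list forms :: ('n, 'k) mpoly"
  let ?J = "gradient_ideal ?F" and ?I = "range (\<lambda>k. \<Sum>i\<in>UNIV - {e1}. k i * pdiff i ?F)"
  let ?x = "pdiff e1 ?F" and ?y = "pdiff e2 ?F" and ?z = "pdiff e3 ?F" and ?w = "pdiff e4 ?F"
  let ?c = "cubic_alternant * (P 1 - P 2) :: ('n, 'k) mpoly"
  assume lt: "linear_type ?J"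
  have J_eq: "?J = range (\<lambda>k. \<Sum>i\<in>UNIV. k i * pdiff i ?F)"
    unfolding gradient_ideal_def by (rule genideal_image_eq)
  note J = ideal_gradient_ideal[of ?F]
  have partial_J: "pdiff i ?F \<in> ?J" for i
    unfolding J_eq by (rule generator_in_combinations) simp_all
  have partial_I: "pdiff i ?F \<in> ?I" if "i \<noteq> e1" for i
    using that by (intro generator_in_combinations) simp_all
  have split: "(\<Sum>i\<in>UNIV. h i) = h e1 + (\<Sum>i\<in>UNIV - {e1}. h i)" for h :: "'n \<Rightarrow> ('n, 'k) mpoly"
    by (rule sum.remove) simp_all
  have comb_J: "r * pdiff i ?F \<in> ?J" "g \<in> ?J \<Longrightarrow> h \<in> ?J \<Longrightarrow> g + h \<in> ?J" "g \<in> ?J \<Longrightarrow> h \<in> ?J \<Longrightarrow> g - h \<in> ?J"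
    for r i g h
    using J[unfolded ideal_ring_on_UNIV_iff] partial_J ideal_diff[OF J] by blast+
  have "\<exists>v2\<in>?J. \<exists>v3\<in>?J. \<exists>v4\<in>?J. ?c * ?x * ?x = ?y * v2 + ?z * v3 + ?w * v4"
    unfolding cubic_alternant_def
    by (subst square_relation[OF _ _ refl refl pdiff_prod_forms(1-4) refl refl pdiff_prod_forms(5)])
      (simp_all add: PQ_simps, intro bexI, rule refl, (intro comb_J)+)
  then obtain v2 v3 v4 where v: "v2 \<in> ?J" "v3 \<in> ?J" "v4 \<in> ?J"
    "?c * ?x * ?x = ?y * v2 + ?z * v3 + ?w * v4" by blast
  have "?c * ?x \<in> ?I"
  proof (rule linear_type_colon[OF lt J ideal_combinations])
    show "?I \<subseteq> ?J"
    proof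
      fix h assume "h \<in> ?I"
      then obtain k where "h = (\<Sum>i\<in>UNIV - {e1}. k i * pdiff i ?F)" by auto
      then have "h = (\<Sum>i\<in>UNIV. (k(e1 := 0)) i * pdiff i ?F)" by (simp add: split)
      then show "h \<in> ?J" unfolding J_eq by (rule range_eqI[of _ _ "k(e1 := 0)"])
    qed
    show "?x \<in> ?J" by (rule partial_J)
    show "\<exists>r. h - r * ?x \<in> ?I" if "h \<in> ?J" for h
    proof -
      obtain k where k: "h = (\<Sum>i\<in>UNIV. k i * pdiff i ?F)" using \<open>h \<in> ?J\<close> unfolding J_eq by auto
      have "h - k e1 * ?x = (\<Sum>i\<in>UNIV - {e1}. k i * pdiff i ?F)"
        by (simp add: k split)
      then show ?thesis by blast
    qed
    show "?c * ?x * ?x = (\<Sum>i\<in>{e2, e3, e4}. pdiff i ?F * (if i = e2 then v2 else if i = e3 then v3 else v4))"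
      using v(4) by (simp add: add.assoc)
  qed (use v partial_I in auto)
  then obtain k where k: "?c * ?x = (\<Sum>i\<in>UNIV - {e1}. k i * pdiff i ?F)" by auto
  \<comment> \<open>a syzygy of the partial derivatives is a derivation that annihilates \<open>F\<close>\<close>
  define \<theta> where "\<theta> i = (if i = e1 then ?c else - k i)" for i
  let ?\<delta> = "\<lambda>g. \<Sum>i\<in>UNIV. \<theta> i * pdiff i g"
  have "?\<delta> ?F = 0"
    using k by (simp add: split \<theta>_def sum_negf)
  moreover have "?\<delta> (P 0) = ?c"
    by (simp add: split PQ_simps pdiff_Var \<theta>_def)
  ultimately show False
    using alternant_not_log_derivative[OF derivation_sum, of \<theta> UNIV] by simp
qed

end

section \<open>Hyperplanes and rank of the arrangement\<close>

lemma linear_form_Var: "linear_form (Var i)"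
  unfolding linear_form_def
  by (rule exI[of _ "\<lambda>j. if j = i then 1 else 0"])
    (simp add: mscale_def if_distrib[of Const] if_distrib[of "\<lambda>x. x * _"] cong: if_cong)

lemma linear_form_diff: "linear_form l \<Longrightarrow> linear_form m \<Longrightarrow> linear_form (l - m)"
  unfolding linear_form_def
proof (elim exE)
  fix a b assume "l = (\<Sum>i\<in>UNIV. mscale (a i) (Var i))" "m = (\<Sum>i\<in>UNIV. mscale (b i) (Var i))"
  then show "\<exists>a. l - m = (\<Sum>i\<in>UNIV. mscale (a i) (Var i))"
    by (intro exI[of _ "\<lambda>i. a i - b i"])
      (simp add: mscale_def Const_def single_diff left_diff_distrib sum_subtractf)
qed

lemma linear_form_uminus: "linear_form l \<Longrightarrow> linear_form (- l)"
  using linear_form_diff[of "l - l" l] linear_form_diff[of l l] by simp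

lemma meval_mscale: "meval (\<lambda>a. a) x (mscale c p) = c * meval (\<lambda>a. a) x p"
  by (simp add: mscale_def ident.meval_rules)

lemma root_vec_sum:
  assumes "j < 3"
  shows "root_vec j 0 + root_vec j 1 + root_vec j 2 = (0 :: 'a::comm_ring_1)"
proof -
  have "j = 0 \<or> j = 1 \<or> j = 2" using assms by linarith
  then show ?thesis by (elim disjE) (simp_all add: root_vec_def)
qed

text \<open>
  A form that is nonzero at some zero of another form is not a multiple of it.
\<close>

lemma not_proportional_of_generic_zeros:
  assumes "\<And>i. i < length ls \<Longrightarrow> \<exists>x. meval (\<lambda>a. a) x (ls ! i) = 0 \<and>
      (\<forall>j<length ls. j \<noteq> i \<longrightarrow> meval (\<lambda>a. a) x (ls ! j) \<noteq> 0)"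
    and "i < length ls" "j < length ls" "i \<noteq> j"
  shows "ls ! i \<noteq> mscale c (ls ! j)"
  using assms(1)[OF assms(3)] assms(2,4) meval_mscale[of _ c "ls ! j"] by force

lemma dim_span_Var:
  "vector_space.dim mscale (module.span mscale (range (Var :: 'n::finite \<Rightarrow> ('n, 'k::field) mpoly))) = CARD('n)"
proof -
  interpret vs: vector_space "mscale :: 'k \<Rightarrow> ('n, 'k) mpoly \<Rightarrow> _" by (rule vector_space_mscale)
  let ?u = "\<lambda>i j. if j = i then 1 else (0 :: 'k)"
  have ev: "meval (\<lambda>a. a) (?u i) (Var j) = ?u i j" for i j :: 'n
    by (rule ident.meval_Var)
  have inj: "inj (Var :: 'n \<Rightarrow> ('n, 'k) mpoly)"
    by (rule injI) (metis ev zero_neq_one)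
  have "vs.independent (range Var)"
  proof (rule vs.independent_if_scalars_zero)
    fix f :: "('n, 'k) mpoly \<Rightarrow> 'k" and v :: "('n, 'k) mpoly"
    assume 0: "(\<Sum>x\<in>range Var. mscale (f x) x) = 0" and "v \<in> range (Var :: 'n \<Rightarrow> ('n, 'k) mpoly)"
    then obtain i where v: "v = Var i" by auto
    have "meval (\<lambda>a. a) (?u i) (\<Sum>x\<in>range Var. mscale (f x) x) = f v"
      by (simp add: sum.reindex[OF inj] ident.meval_sum meval_mscale ev v if_distrib[of "\<lambda>x. _ * x"] cong: if_cong)
    then show "f v = 0" unfolding 0 by (simp add: ident.meval_zero)
  qed simp
  then have "vs.dim (vs.span (range Var)) = card (range (Var :: 'n \<Rightarrow> ('n, 'k) mpoly))"
    by (rule vs.dim_span_eq_card_independent)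
  then show ?thesis using card_image[OF inj] by simp
qed

context coordinates
begin

lemma forms_central_arrangement:
  "central_arrangement (vanishing_locus ` set forms) (forms :: ('n, 'k::field_char_0) mpoly list)"
proof -
  let ?ls = "forms :: ('n, 'k) mpoly list"
  have len: "length ?ls = 9 + length xs" by (simp add: forms_def)
  have nth1: "?ls ! k = P (k div 3) - Q (k mod 3)" if "k < 9" for k
    using that by (simp add: forms_def nth_append)
  have nth2: "?ls ! (9 + m) = Var (xs ! m)" if "m < length xs" for m
    using that by (simp add: forms_def nth_append)
  have gen: "\<exists>x. meval (\<lambda>a. a) x (?ls ! i) = 0 \<and>
      (\<forall>j<length ?ls. j \<noteq> i \<longrightarrow> meval (\<lambda>a. a) x (?ls ! j) \<noteq> 0)" if i: "i < length ?ls" for i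
  proof (cases "i < 9")
    case True
    \<comment> \<open>the entries of the two triples are \<open>0, 1, -1\<close> and \<open>0, 2, -2\<close>, so they meet only in the zeros\<close>
    let ?p = "root_vec (i div 3) :: nat \<Rightarrow> 'k" and ?q = "\<lambda>j. 2 * root_vec (i mod 3) j :: 'k"
    have i3: "i div 3 < 3" "i mod 3 < 3" using True by simp_all
    have sums: "?p 0 + ?p 1 + ?p 2 = 0" "?q 0 + ?q 1 + ?q 2 = 0"
      by (simp_all only: distrib_left[symmetric] root_vec_sum[OF i3(1)] root_vec_sum[OF i3(2)] mult_zero_right)
    note ev = meval_form[OF ident.coeff_hom_axioms sums, of _ 1]
    have "meval (\<lambda>a. a) (pt ?p ?q 1) (?ls ! i) = 0"
      unfolding nth1[OF True] ev[OF True] by (simp add: root_vec_def)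
    moreover have "meval (\<lambda>a. a) (pt ?p ?q 1) (?ls ! j) \<noteq> 0" if "j < length ?ls" "j \<noteq> i" for j
    proof (cases "j < 9")
      case j: True
      have "j div 3 \<noteq> i div 3 \<or> j mod 3 \<noteq> i mod 3"
        using \<open>j \<noteq> i\<close> by (metis div_mult_mod_eq)
      then have "?p (j div 3) \<noteq> ?q (j mod 3)"
        by (simp add: root_vec_def)
      then show ?thesis unfolding nth1[OF j] ev[OF j] by simp
    next
      case False
      then obtain m where m: "j = 9 + m" "m < length xs"
        using \<open>j < length ?ls\<close> len by (metis add_less_cancel_left le_add_diff_inverse not_less)
      then show ?thesis by (simp add: nth2 ident.meval_Var)
    qed
    ultimately show ?thesis by blast
  next
    case False
    then obtain m where m: "i = 9 + m" "m < length xs"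
      using i len by (metis add_less_cancel_left le_add_diff_inverse not_less)
    let ?q = "\<lambda>j. if j = 2 then - 2 else (1 :: 'k)"
    let ?x = "(pt (\<lambda>_. 0) ?q 1)(xs ! m := 0)"
    have notin: "xs ! m \<noteq> e1" "xs ! m \<noteq> e2" "xs ! m \<noteq> e3" "xs ! m \<noteq> e4"
      using m(2) neq nth_mem[of m xs] by metis+
    have "meval (\<lambda>a. a) ?x (?ls ! i) = 0"
      using m by (simp add: nth2 ident.meval_Var)
    moreover have "meval (\<lambda>a. a) ?x (?ls ! j) \<noteq> 0" if "j < length ?ls" "j \<noteq> i" for j
    proof (cases "j < 9")
      case j: True
      have "j div 3 = 0 \<or> j div 3 = 1 \<or> j div 3 = 2" "j mod 3 = 0 \<or> j mod 3 = 1 \<or> j mod 3 = 2"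
        using j by linarith+
      then show ?thesis using notin
        by (auto simp: nth1[OF j] P_def Q_def trace_free_def ident.meval_rules)
    next
      case False
      then obtain l where l: "j = 9 + l" "l < length xs"
        using \<open>j < length ?ls\<close> len by (metis add_less_cancel_left le_add_diff_inverse not_less)
      then have "xs ! l \<noteq> xs ! m"
        using m \<open>j \<noteq> i\<close> dist by (auto simp: nth_eq_iff_index_eq)
      then show ?thesis using l by (simp add: nth2 ident.meval_Var)
    qed
    ultimately show ?thesis by blast
  qed
  have nonzero: "l \<noteq> 0" if l: "l \<in> set ?ls" for l
  proof -
    obtain i where i: "i < length ?ls" "l = ?ls ! i" using l unfolding in_set_conv_nth by blast
    obtain j where "j < length ?ls" "j \<noteq> i"
      using len by (cases "i = 0") (auto intro: that[of 0] that[of 1])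
    from gen[OF this(1)] i this(2) have "\<exists>x. meval (\<lambda>a. a) x l \<noteq> 0" by auto
    then show ?thesis by (auto simp: ident.meval_zero)
  qed
  have "linear_form (P i)" "linear_form (Q i)" for i
    by (auto simp: P_def Q_def trace_free_def intro!: linear_form_diff linear_form_uminus linear_form_Var)
  then have "linear_form l" if "l \<in> set ?ls" for l
    using that by (auto simp: forms_def intro!: linear_form_diff linear_form_Var)
  with nonzero show ?thesis
    unfolding central_arrangement_def
    using not_proportional_of_generic_zeros[of ?ls, OF gen] by blast
qed

text \<open>
  Summing the forms \<open>p\<^sub>i - q\<^sub>j\<close> over \<open>j\<close> gives \<open>3 p\<^sub>i\<close>, and summing over \<open>i\<close> gives \<open>- 3 q\<^sub>j\<close>, so the forms
  span all variables in characteristic zero.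
\<close>

lemma forms_rank: "arrangement_rank (forms :: ('n, 'k::field_char_0) mpoly list) = CARD('n)"
proof -
  interpret vs: vector_space "mscale :: 'k \<Rightarrow> ('n, 'k) mpoly \<Rightarrow> _" by (rule vector_space_mscale)
  let ?S = "set forms :: ('n, 'k) mpoly set"
  let ?L = "\<lambda>k. P (k div 3) - Q (k mod 3) :: ('n, 'k) mpoly"
  have L: "?L k \<in> vs.span ?S" if "k < 9" for k
    using that by (intro vs.span_base) (auto simp: forms_def)
  have third: "Var e \<in> vs.span ?S" if "3 * Var e \<in> vs.span ?S" for e
  proof -
    have "Const (1 / 3) * Const 3 = (Const 1 :: ('n, 'k) mpoly)"
      by (simp only: Const_def mult_single) simp
    then have "mscale (1 / 3) (3 * Var e) = (Var e :: ('n, 'k) mpoly)"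
      by (simp add: mscale_def mult.assoc[symmetric])
    then show ?thesis using vs.span_scale[OF that, of "1 / 3"] by simp
  qed
  have "?L 0 + ?L 1 + ?L 2 = 3 * Var e1" "?L 3 + ?L 4 + ?L 5 = 3 * Var e2"
    "- (?L 0 + ?L 3 + ?L 6) = 3 * Var e3" "- (?L 1 + ?L 4 + ?L 7) = 3 * Var e4"
    by (simp_all add: P_def Q_def trace_free_def)
  moreover have "?L 0 + ?L 1 + ?L 2 \<in> vs.span ?S" "?L 3 + ?L 4 + ?L 5 \<in> vs.span ?S"
    "- (?L 0 + ?L 3 + ?L 6) \<in> vs.span ?S" "- (?L 1 + ?L 4 + ?L 7) \<in> vs.span ?S"
    by (intro vs.span_neg vs.span_add L; simp)+
  ultimately have "Var e \<in> vs.span ?S" if "e \<in> {e1, e2, e3, e4}" for e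
    using that by (intro third) auto
  moreover have "Var e \<in> vs.span ?S" if "e \<in> set xs" for e
    using that by (intro vs.span_base) (auto simp: forms_def)
  ultimately have "Var e \<in> vs.span ?S" for e
    using all UNIV_I[of e] by (metis Un_iff insert_iff list.set set_append)
  moreover have V: "Var e \<in> vs.span (range Var)" for e :: 'n
    by (intro vs.span_base) auto
  then have "P i \<in> vs.span (range Var)" "Q i \<in> vs.span (range Var)" for i
    by (auto simp: P_def Q_def trace_free_def intro!: vs.span_diff vs.span_neg)
  then have "?S \<subseteq> vs.span (range Var)"
    using V by (auto simp: forms_def intro!: vs.span_diff)
  ultimately have "vs.span ?S = vs.span (range Var)"
    by (subst vs.span_eq) auto
  then show ?thesis unfolding arrangement_rank_def by (simp only: dim_span_Var)
qed

end


lemma coordinates_exist: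
  assumes "CARD('n::finite) \<ge> 4"
  shows "\<exists>e1 e2 e3 e4 (xs :: 'n list). coordinates e1 e2 e3 e4 xs"
proof -
  obtain ys :: "'n list" where ys: "set ys = UNIV" "distinct ys"
    using finite_distinct_list[of "UNIV :: 'n set"] by auto
  then have "4 \<le> length ys" using assms by (metis distinct_card)
  then obtain e1 e2 e3 e4 xs where "ys = [e1, e2, e3, e4] @ xs"
    by (auto simp: numeral_eq_Suc Suc_le_length_iff)
  with ys have "coordinates e1 e2 e3 e4 xs" by (simp add: coordinates_def)
  then show ?thesis by blast
qed

theorem theorem3p5:
  assumes "CARD('n::finite) \<ge> 4"
  shows "\<exists>(\<A> :: ('n \<Rightarrow> 'k::field_char_0) set set) ls.
    central_arrangement \<A> ls \<and> arrangement_rank ls = CARD('n) \<and>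
    \<not> linear_type (gradient_ideal (prod_list ls))"
proof -
  obtain e1 e2 e3 e4 and xs :: "'n list" where "coordinates e1 e2 e3 e4 xs"
    using coordinates_exist[OF assms] by blast
  then interpret coordinates e1 e2 e3 e4 xs .
  show ?thesis
    using forms_central_arrangement forms_rank gradient_ideal_forms_not_linear_type by blast
qed

end
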